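(* Consider the Euler forward time discretization, described in the context, of the two-dimensional scheme with central and Lax–Friedrichs fluxes, with time step $\tau$, and let $l\in\{1,\dots,m\}$. 1. Suppose $\rho_{h,l}^n(x_i^r,y_j^s)\ge0$ for all $i,j,r,s$. Take $$\tau\le\frac12\min_{r,s,i,j}\left(\left(\frac{w_1h_i^x}{\alpha^x+v_{h,l}^x}\right)(x_{i-\frac12}^+,y_j^s),\ \left(\frac{w_{k+1}h_i^x}{\alpha^x-v_{h,l}^x}\right)(x_{i+\frac12}^-,y_j^s),\ \left(\frac{w_1h_j^y}{\alpha^y+v_{h,l}^y}\right)(x_i^r,y_{j-\frac12}^+),\ \left(\frac{w_{k+1}h_j^y}{\alpha^y-v_{h,l}^y}\right)(x_i^r,y_{j+\frac12}^-)\right).$$ Then the preliminary solution $(\rho_{h,l})_{i,j}^{n+1,\mathrm{pre}}$ obtained through the Euler forward time discretization has non-negative cell averages $(\bar\rho_{h,l})_{i,j}^{n+1,\mathrm{pre}}$. 2. Let $$\theta_{l,i,j}=\min\left(\frac{(\bar\rho_{h,l})_{i,j}^{n+1,\mathrm{pre}}}{(\bar\rho_{h,l})_{i,j}^{n+1,\mathrm{pre}}-\rho^{\min}_{l,i,j}},1\right),\qquad\rho^{\min}_{l,i,j}=\min_{r,s}\left(\rho_{h,l}^{n+1,\mathrm{pre}}(x_i^r,y_j^s)\right),$$ and define $\rho_{h,l}^{n+1}\in V_h$ so that $$\rho_{h,l}^{n+1}(x_i^r,y_j^s)=(\bar\rho_{h,l})_{i,j}^{n+1,\mathrm{pre}}+\theta_{l,i,j}\left(\rho_{h,l}^{n+1,\mathrm{pre}}(x_i^r,y_j^s)-(\bar\rho_{h,l})_{i,j}^{n+1,\mathrm{pre}}\right).$$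 Then $\rho_{h,l}^{n+1}(x_i^r,y_j^s)$ is non-negative. Furthermore, $\rho_{h,l}^{n+1}$ maintains the spatial accuracy achieved by $\rho_{h,l}^{n+1,\mathrm{pre}}$, in the sense that for all $(x,y)\in I_i\times J_j$, $$|\rho_{h,l}^{n+1}(x,y)-\rho_{h,l}^{n+1,\mathrm{pre}}(x,y)|\le C_k\max_{(x',y')\in I_i\times J_j}|\rho_l(x',y',t_{n+1})-\rho_{h,l}^{n+1,\mathrm{pre}}(x',y')|,$$ where $\rho_l$ is the $l$-th component of the exact (non-negative) solution and $C_k$ depends only on $k$.
   Context: **Continuous problem.** On a rectangle $\Omega=I\times J$ consider $\partial_t\boldsymbol\rho=\partial_x(F(\boldsymbol\rho)\partial_x\boldsymbol\xi(\boldsymbol\rho))+\partial_y(F(\boldsymbol\rho)\partial_y\boldsymbol\xi(\boldsymbol\rho))$ for $\boldsymbol\rho=(\rho_1,\dots,\rho_m)^T$. Here $e=e(\boldsymbol\rho)$ is a scalar-valued twice differentiable convex function, $\boldsymbol\xi=(\partial_{\rho_1}e,\dots,\partial_{\rho_m}e)^T$, and $F(\boldsymbol\rho)$ is an $m\times m$ matrix, possibly non-symmetric, with $\boldsymbol z\cdot F\boldsymbol z\ge0$ for all $\boldsymbol z\in\mathbb R^m$. The exact solution is non-negative. The periodic boundary condition (or compact support, treated in the same way) is assumed: opposite sides of $\Omega$ are identified. The matrix $\mathrm{diag}(\boldsymbol\rho)^{-1}F(\boldsymbol\rho)$ is assumed bounded; i.e. $F(\boldsymbol\rho)=\mathrm{diag}(\boldsymbol\rho)G(\boldsymbol\rho)$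 with $G$ bounded, and $\mathrm{diag}(\boldsymbol\rho)^{-1}F(\boldsymbol\rho)$ is understood as $G(\boldsymbol\rho)$, also where components of $\boldsymbol\rho$ vanish. All quantities in the scheme are assumed well-defined. **Mesh and space.** A regular Cartesian mesh: $I=\bigcup_{i=1}^{N^x}I_i$, $I_i=(x_{i-\frac12},x_{i+\frac12})$, $J=\bigcup_{j=1}^{N^y}J_j$, $J_j=(y_{j-\frac12},y_{j+\frac12})$, $h_i^x=x_{i+\frac12}-x_{i-\frac12}$, $h_j^y=y_{j+\frac12}-y_{j-\frac12}$. For $k\ge1$, $V_h=\{v_h: v_h|_{I_i\times J_j}\in Q^k(I_i\times J_j)\ \forall i,j\}$, where $Q^k(I_i\times J_j)$ is the tensor product of $P^k(I_i)$ and $P^k(J_j)$ ($P^k$: polynomials of degree at most $k$), and $\boldsymbol V_h=\prod_{l=1}^mV_h$. Superscripts $\pm$ on an interface coordinate denote one-sided limits, $\{\boldsymbol v\}_{i+\frac12}(y)=\frac12(\boldsymbol v(x_{i+\frac12}^+,y)+\boldsymbol v(x_{i+\frac12}^-,y))$, $[\boldsymbol v]_{i+\frac12}(y)=\boldsymbol v(x_{i+\frac12}^+,y)-\boldsymbol v(x_{i+\frac12}^-,y)$, and similarly $\{\boldsymbol v\}_{j+\frac12}(x)$, $[\boldsymbol v]_{j+\frac12}(x)$. A bar with subscripts $i,j$ denotes the average over $I_i\times J_j$; the second subscript $l$ denotes the $l$-th component. **Quadrature.** $\{x_i^r\}_{r=1}^{k+1}$ and $\{y_j^s\}_{s=1}^{k+1}$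 are the Gauss–Lobatto points on $I_i$ and $J_j$ in increasing order (endpoints included, with one-sided limits from inside the cell), with weights $w_r$ on $[-1,1]$ (so $\sum_rw_r=2$); $\widetilde{\int_{I_i}}f\,dx=\frac{h_i^x}{2}\sum_rw_rf(x_i^r)$ and $\widetilde{\int_{J_j}}f\,dy=\frac{h_j^y}{2}\sum_sw_sf(y_j^s)$. Whenever a derivative $\partial_x\boldsymbol\psi$ or $\partial_y\boldsymbol\psi$ appears in a quadrature, $\boldsymbol\psi$ is first replaced by its componentwise degree-$k$ (tensor-product) interpolation polynomial at the Gauss–Lobatto points of the cell. **Euler forward scheme.** Given $\boldsymbol\rho_h^n\in\boldsymbol V_h$, put $F_h=F(\boldsymbol\rho_h^n)$, $\boldsymbol\xi_h=\boldsymbol\xi(\boldsymbol\rho_h^n)$, and let $\boldsymbol u_h^x,\boldsymbol u_h^y\in\boldsymbol V_h$ satisfy, for all $\boldsymbol\psi_h^x,\boldsymbol\psi_h^y\in\boldsymbol V_h$ and all $i,j$, $$\begin{aligned}\widetilde{\int_{J_j}}\widetilde{\int_{I_i}}\left(\boldsymbol u_h^x\cdot\boldsymbol\psi_h^x+\boldsymbol u_h^y\cdot\boldsymbol\psi_h^y\right)dxdy=&-\widetilde{\int_{J_j}}\widetilde{\int_{I_i}}\boldsymbol\xi_h\cdot(\partial_x\boldsymbol\psi_h^x+\partial_y\boldsymbol\psi_h^y)\,dxdy\\&+\widetilde{\int_{J_j}}\left(\widehat{\boldsymbol\xi}_{i+\frac12}(y)\cdot\boldsymbol\psi_h^x(x_{i+\frac12}^-,y)-\widehat{\boldsymbol\xi}_{i-\frac12}(y)\cdot\boldsymbol\psi_h^x(x_{i-\frac12}^+,y)\right)dy\\&+\widetilde{\int_{I_i}}\left(\widehat{\boldsymbol\xi}_{j+\frac12}(x)\cdot\boldsymbol\psi_h^y(x,y_{j+\frac12}^-)-\widehat{\boldsymbol\xi}_{j-\frac12}(x)\cdot\boldsymbol\psi_h^y(x,y_{j-\frac12}^+)\right)dx.\end{aligned}$$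 The preliminary solution $\boldsymbol\rho_h^{n+1,\mathrm{pre}}\in\boldsymbol V_h$ is defined by: for all $\boldsymbol\varphi_h\in\boldsymbol V_h$ and all $i,j$, $$\begin{aligned}\widetilde{\int_{J_j}}\widetilde{\int_{I_i}}\frac{\boldsymbol\rho_h^{n+1,\mathrm{pre}}-\boldsymbol\rho_h^n}{\tau}\cdot\boldsymbol\varphi_h\,dxdy=&-\widetilde{\int_{J_j}}\widetilde{\int_{I_i}}\left(F_h\boldsymbol u_h^x\cdot\partial_x\boldsymbol\varphi_h+F_h\boldsymbol u_h^y\cdot\partial_y\boldsymbol\varphi_h\right)dxdy\\&+\widetilde{\int_{J_j}}\left(\widehat{F\boldsymbol u^x}_{i+\frac12}(y)\cdot\boldsymbol\varphi_h(x_{i+\frac12}^-,y)-\widehat{F\boldsymbol u^x}_{i-\frac12}(y)\cdot\boldsymbol\varphi_h(x_{i-\frac12}^+,y)\right)dy\\&+\widetilde{\int_{I_i}}\left(\widehat{F\boldsymbol u^y}_{j+\frac12}(x)\cdot\boldsymbol\varphi_h(x,y_{j+\frac12}^-)-\widehat{F\boldsymbol u^y}_{j-\frac12}(x)\cdot\boldsymbol\varphi_h(x,y_{j-\frac12}^+)\right)dx.\end{aligned}$$ Central and Lax–Friedrichs fluxes: $\widehat{\boldsymbol\xi}_{i+\frac12}(y)=\{\boldsymbol\xi_h\}_{i+\frac12}(y)$, $\widehat{\boldsymbol\xi}_{j+\frac12}(x)=\{\boldsymbol\xi_h\}_{j+\frac12}(x)$, $$\widehat{F\boldsymbol u^x}_{i+\frac12}(y)=\left(\{F_h\boldsymbol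 u_h^x\}_{i+\frac12}+\tfrac{\alpha^x_{i+\frac12}}{2}[\boldsymbol\rho_h^n]_{i+\frac12}\right)(y),\quad\alpha^x_{i+\frac12}(y)=\max(|\boldsymbol v_h^x(x_{i+\frac12}^+,y)|_\infty,|\boldsymbol v_h^x(x_{i+\frac12}^-,y)|_\infty),$$ $$\widehat{F\boldsymbol u^y}_{j+\frac12}(x)=\left(\{F_h\boldsymbol u_h^y\}_{j+\frac12}+\tfrac{\alpha^y_{j+\frac12}}{2}[\boldsymbol\rho_h^n]_{j+\frac12}\right)(x),\quad\alpha^y_{j+\frac12}(x)=\max(|\boldsymbol v_h^y(x,y_{j+\frac12}^+)|_\infty,|\boldsymbol v_h^y(x,y_{j+\frac12}^-)|_\infty),$$ with $\boldsymbol v_h^x=\mathrm{diag}(\boldsymbol\rho_h^n)^{-1}F_h\boldsymbol u_h^x$, $\boldsymbol v_h^y=\mathrm{diag}(\boldsymbol\rho_h^n)^{-1}F_h\boldsymbol u_h^y$ and $|\cdot|_\infty$ the $\ell^\infty$ norm on $\mathbb R^m$. In the time step restriction, $\alpha^x$ at $(x_{i\pm\frac12}^\mp,y)$ means $\alpha^x_{i\pm\frac12}(y)$, and $\alpha^y$ at $(x,y_{j\pm\frac12}^\mp)$ means $\alpha^y_{j\pm\frac12}(x)$. **Conventions.** A quotient with zero denominator in the time step restriction is read as $+\infty$; if $(\bar\rho_{h,l})_{i,j}^{n+1,\mathrm{pre}}=\rho^{\min}_{l,i,j}$ then $\theta_{l,i,j}=1$. Part 2 refers to the preliminary solution of part 1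 (under the hypotheses of part 1). *)

theory Defs
  imports "HOL-Analysis.Analysis" "HOL-Computational_Algebra.Polynomial"
begin

text \<open>
  Vectors in \<open>\<real>\<^sup>m\<close> are the points of \<open>Euclidean_space m\<close>, that is functions on \<open>nat\<close>
  that vanish from \<open>m\<close> on, so that \<open>m\<close> can be quantified over inside a formula.
  Cells, quadrature points and vector components are numbered from \<open>0\<close>.
\<close>

text \<open>
  Rodrigues' formula. The interior Gauss--Lobatto points are the zeros of the derivative of the
  Legendre polynomial of degree \<open>k\<close>, the weights are the integrals of the Lagrange basis.
\<close>

definition legendre :: "nat \<Rightarrow> real poly" where
  "legendre k = smult (1 / (2 ^ k * fact k)) ((pderiv ^^ k) ([:-1, 0, 1:] ^ k))"

definition gl_node :: "nat \<Rightarrow> nat \<Rightarrow> real" where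
  "gl_node k r = sorted_list_of_set ({-1, 1} \<union> {t. poly (pderiv (legendre k)) t = 0}) ! r"

definition gl_weight :: "nat \<Rightarrow> nat \<Rightarrow> real" where
  "gl_weight k r =
     integral {-1..1} (\<lambda>t. \<Prod>s\<in>{..k} - {r}. (t - gl_node k s) / (gl_node k r - gl_node k s))"

definition dot :: "nat \<Rightarrow> (nat \<Rightarrow> real) \<Rightarrow> (nat \<Rightarrow> real) \<Rightarrow> real" where
  "dot m a b = (\<Sum>l<m. a l * b l)"

definition mat_vec :: "nat \<Rightarrow> (nat \<Rightarrow> nat \<Rightarrow> real) \<Rightarrow> (nat \<Rightarrow> real) \<Rightarrow> nat \<Rightarrow> real" where
  "mat_vec m A z = (\<lambda>a. \<Sum>b<m. A a b * z b)"

definition linf_norm :: "nat \<Rightarrow> (nat \<Rightarrow> real) \<Rightarrow> real" where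
  "linf_norm m z = Max ((\<lambda>l. \<bar>z l\<bar>) ` {..<m})"

definition grad :: "((nat \<Rightarrow> real) \<Rightarrow> real) \<Rightarrow> (nat \<Rightarrow> real) \<Rightarrow> nat \<Rightarrow> real" where
  "grad f z = (\<lambda>l. deriv (\<lambda>t. f (z(l := t))) (z l))"

text \<open>Frechet differentiability on \<open>\<real>\<^sup>m\<close>; function types carry no norm, so the class-based
  notion is not applicable.\<close>

definition differentiable_Rm :: "nat \<Rightarrow> ((nat \<Rightarrow> real) \<Rightarrow> real) \<Rightarrow> (nat \<Rightarrow> real) \<Rightarrow> bool" where
  "differentiable_Rm m f z \<longleftrightarrow>
     (\<exists>d. ((\<lambda>z'. (f z' - f z - (\<Sum>l<m. d l * (z' l - z l))) / L2_set (\<lambda>l. z' l - z l) {..<m})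
            \<longlongrightarrow> 0) (atin (Euclidean_space m) z))"

definition twice_differentiable_Rm ::
    "nat \<Rightarrow> (nat \<Rightarrow> real) set \<Rightarrow> ((nat \<Rightarrow> real) \<Rightarrow> real) \<Rightarrow> bool" where
  "twice_differentiable_Rm m U f \<longleftrightarrow>
     (\<forall>z\<in>U. differentiable_Rm m f z \<and> (\<forall>l<m. differentiable_Rm m (\<lambda>z'. grad f z' l) z))"

text \<open>Convexity of the domain is part of the notion, as in \<open>convex_on\<close>.\<close>

definition convex_Rm :: "(nat \<Rightarrow> real) set \<Rightarrow> ((nat \<Rightarrow> real) \<Rightarrow> real) \<Rightarrow> bool" where
  "convex_Rm U f \<longleftrightarrow>
     (\<forall>a\<in>U. \<forall>b\<in>U. \<forall>t\<in>{0..1}.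
        (\<lambda>l. (1 - t) * a l + t * b l) \<in> U \<and>
        f (\<lambda>l. (1 - t) * a l + t * b l) \<le> (1 - t) * f a + t * f b)"

text \<open>
  The entropy \<open>e\<close> lives on an open convex set \<open>U\<close> and the structural assumptions on \<open>F\<close>
  hold on a set \<open>S \<subseteq> U\<close> of admissible states; e.g. \<open>F \<rho> = diag \<rho>\<close> is positive semi-definite
  only for non-negative \<open>\<rho>\<close>, and \<open>\<rho> ln \<rho>\<close> is differentiable only for positive \<open>\<rho>\<close>.
  \<open>G\<close> plays the role of \<open>diag \<rho>\<^sup>-\<^sup>1 F\<close>, also where components of \<open>\<rho>\<close> vanish.
\<close>

definition gradient_flow_data ::
    "nat \<Rightarrow> (nat \<Rightarrow> real) set \<Rightarrow> (nat \<Rightarrow> real) set \<Rightarrow> ((nat \<Rightarrow> real) \<Rightarrow> real) \<Rightarrow>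
     ((nat \<Rightarrow> real) \<Rightarrow> nat \<Rightarrow> nat \<Rightarrow> real) \<Rightarrow> ((nat \<Rightarrow> real) \<Rightarrow> nat \<Rightarrow> nat \<Rightarrow> real) \<Rightarrow> bool" where
  "gradient_flow_data m U S e F G \<longleftrightarrow>
     openin (Euclidean_space m) U \<and> twice_differentiable_Rm m U e \<and> convex_Rm U e \<and> S \<subseteq> U \<and>
     (\<forall>\<rho>\<in>S. \<forall>z. 0 \<le> dot m z (mat_vec m (F \<rho>) z)) \<and>
     (\<forall>\<rho>\<in>S. \<forall>a<m. \<forall>b<m. F \<rho> a b = \<rho> a * G \<rho> a b) \<and>
     (\<exists>B. \<forall>\<rho>\<in>S. \<forall>a<m. \<forall>b<m. \<bar>G \<rho> a b\<bar> \<le> B)"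

text \<open>\<open>xp 0, ..., xp nx\<close> and \<open>yp 0, ..., yp ny\<close> are the mesh points, i.e. \<open>xp i\<close> and \<open>xp (i + 1)\<close>
  are the end points of cell \<open>i\<close> for \<open>i < nx\<close>.\<close>

record mesh =
  nx :: nat
  ny :: nat
  xp :: "nat \<Rightarrow> real"
  yp :: "nat \<Rightarrow> real"

definition wf_mesh :: "mesh \<Rightarrow> bool" where
  "wf_mesh M \<longleftrightarrow> 1 \<le> nx M \<and> 1 \<le> ny M \<and>
     (\<forall>i<nx M. xp M i < xp M (Suc i)) \<and> (\<forall>j<ny M. yp M j < yp M (Suc j))"

definition hx :: "mesh \<Rightarrow> nat \<Rightarrow> real" where
  "hx M i = xp M (Suc i) - xp M i"

definition hy :: "mesh \<Rightarrow> nat \<Rightarrow> real" where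
  "hy M j = yp M (Suc j) - yp M j"

text \<open>
  A non-negative classical solution on \<open>[0, T]\<close>. Identifying opposite sides of the rectangle,
  it is given as a function on the plane that is periodic with the side lengths as periods.
\<close>

definition exact_solution ::
    "mesh \<Rightarrow> nat \<Rightarrow> (nat \<Rightarrow> real) set \<Rightarrow> ((nat \<Rightarrow> real) \<Rightarrow> real) \<Rightarrow>
     ((nat \<Rightarrow> real) \<Rightarrow> nat \<Rightarrow> nat \<Rightarrow> real) \<Rightarrow> real \<Rightarrow> (real \<Rightarrow> real \<Rightarrow> real \<Rightarrow> nat \<Rightarrow> real) \<Rightarrow> bool" where
  "exact_solution M m S e F T \<rho> \<longleftrightarrow>
     (let \<xi> = (\<lambda>t x y. grad e (\<rho> t x y));
          fx = (\<lambda>t x y. mat_vec m (F (\<rho> t x y)) (\<lambda>b. deriv (\<lambda>x'. \<xi> t x' y b) x));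
          fy = (\<lambda>t x y. mat_vec m (F (\<rho> t x y)) (\<lambda>b. deriv (\<lambda>y'. \<xi> t x y' b) y))
      in (\<forall>t\<in>{0..T}. \<forall>x y.
            \<rho> t (x + (xp M (nx M) - xp M 0)) y = \<rho> t x y \<and>
            \<rho> t x (y + (yp M (ny M) - yp M 0)) = \<rho> t x y) \<and>
         (\<forall>l<m. continuous_on ({0..T} \<times> UNIV) (\<lambda>(t, x, y). \<rho> t x y l)) \<and>
         (\<forall>t\<in>{0..T}. \<forall>x y. \<forall>l<m. 0 \<le> \<rho> t x y l) \<and>
         (\<forall>t\<in>{0<..<T}. \<forall>x y. \<rho> t x y \<in> S) \<and>
         (\<forall>t\<in>{0<..<T}. \<forall>x y. \<forall>l<m.
            (\<lambda>x'. \<xi> t x' y l) differentiable (at x) \<and>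
            (\<lambda>y'. \<xi> t x y' l) differentiable (at y) \<and>
            (\<lambda>x'. fx t x' y l) differentiable (at x) \<and>
            (\<lambda>y'. fy t x y' l) differentiable (at y) \<and>
            ((\<lambda>t'. \<rho> t' x y l) has_real_derivative
               deriv (\<lambda>x'. fx t x' y l) x + deriv (\<lambda>y'. fy t x y' l) y) (at t)))"

text \<open>
  A piecewise function \<open>v\<close> is represented by its pieces: \<open>v i j\<close> is the branch on cell
  \<open>(i, j)\<close>. The branches of a discontinuous Galerkin function are polynomials on the whole plane,
  so its one-sided limits at the boundary of a cell are values of the branch there.
\<close>

type_synonym 'a pwfun = "nat \<Rightarrow> nat \<Rightarrow> real \<Rightarrow> real \<Rightarrow> 'a"

definition tensor_polys :: "nat \<Rightarrow> (real \<Rightarrow> real \<Rightarrow> real) set" where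
  "tensor_polys k = {f. \<exists>c. \<forall>x y. f x y = (\<Sum>a\<le>k. \<Sum>b\<le>k. c a b * x ^ a * y ^ b)}"

definition dg_space :: "mesh \<Rightarrow> nat \<Rightarrow> real pwfun set" where
  "dg_space M k = {v. \<forall>i<nx M. \<forall>j<ny M. v i j \<in> tensor_polys k}"

definition dg_vec_space :: "mesh \<Rightarrow> nat \<Rightarrow> nat \<Rightarrow> (nat \<Rightarrow> real) pwfun set" where
  "dg_vec_space M k m =
     {v. (\<forall>l<m. (\<lambda>i j x y. v i j x y l) \<in> dg_space M k) \<and>
         (\<forall>i<nx M. \<forall>j<ny M. \<forall>x y. v i j x y \<in> topspace (Euclidean_space m))}"

text \<open>
  Traces at the interfaces. Vertical interface \<open>p \<le> nx\<close> is at \<open>xp p\<close>, horizontal interface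
  \<open>q \<le> ny\<close> at \<open>yp q\<close>; cell \<open>(i, j)\<close> has the vertical interfaces \<open>i\<close>, \<open>i + 1\<close> and the horizontal
  interfaces \<open>j\<close>, \<open>j + 1\<close>. Periodicity identifies interface \<open>0\<close> with \<open>nx\<close> resp. \<open>ny\<close>, whence
  the reductions modulo \<open>nx\<close> and \<open>ny\<close>.
\<close>

definition x_plus :: "mesh \<Rightarrow> 'a pwfun \<Rightarrow> nat \<Rightarrow> nat \<Rightarrow> real \<Rightarrow> 'a" where
  "x_plus M v p j y = (let i = p mod nx M in v i j (xp M i) y)"

definition x_minus :: "mesh \<Rightarrow> 'a pwfun \<Rightarrow> nat \<Rightarrow> nat \<Rightarrow> real \<Rightarrow> 'a" where
  "x_minus M v p j y = (let i = (p + nx M - 1) mod nx M in v i j (xp M (Suc i)) y)"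

definition y_plus :: "mesh \<Rightarrow> 'a pwfun \<Rightarrow> nat \<Rightarrow> nat \<Rightarrow> real \<Rightarrow> 'a" where
  "y_plus M v i q x = (let j = q mod ny M in v i j x (yp M j))"

definition y_minus :: "mesh \<Rightarrow> 'a pwfun \<Rightarrow> nat \<Rightarrow> nat \<Rightarrow> real \<Rightarrow> 'a" where
  "y_minus M v i q x = (let j = (q + ny M - 1) mod ny M in v i j x (yp M (Suc j)))"

definition mean :: "(nat \<Rightarrow> real) \<Rightarrow> (nat \<Rightarrow> real) \<Rightarrow> nat \<Rightarrow> real" where
  "mean a b = (\<lambda>l. (a l + b l) / 2)"

definition x_node :: "mesh \<Rightarrow> nat \<Rightarrow> nat \<Rightarrow> nat \<Rightarrow> real" where
  "x_node M k i r = (xp M i + xp M (Suc i)) / 2 + hx M i / 2 * gl_node k r"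

definition y_node :: "mesh \<Rightarrow> nat \<Rightarrow> nat \<Rightarrow> nat \<Rightarrow> real" where
  "y_node M k j s = (yp M j + yp M (Suc j)) / 2 + hy M j / 2 * gl_node k s"

definition quad_x :: "mesh \<Rightarrow> nat \<Rightarrow> nat \<Rightarrow> (real \<Rightarrow> real) \<Rightarrow> real" where
  "quad_x M k i f = hx M i / 2 * (\<Sum>r\<le>k. gl_weight k r * f (x_node M k i r))"

definition quad_y :: "mesh \<Rightarrow> nat \<Rightarrow> nat \<Rightarrow> (real \<Rightarrow> real) \<Rightarrow> real" where
  "quad_y M k j f = hy M j / 2 * (\<Sum>s\<le>k. gl_weight k s * f (y_node M k j s))"

definition dx :: "(nat \<Rightarrow> real) pwfun \<Rightarrow> (nat \<Rightarrow> real) pwfun" where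
  "dx v i j x y = (\<lambda>l. deriv (\<lambda>x'. v i j x' y l) x)"

definition dy :: "(nat \<Rightarrow> real) pwfun \<Rightarrow> (nat \<Rightarrow> real) pwfun" where
  "dy v i j x y = (\<lambda>l. deriv (\<lambda>y'. v i j x y' l) y)"

definition xi_h :: "((nat \<Rightarrow> real) \<Rightarrow> real) \<Rightarrow> (nat \<Rightarrow> real) pwfun \<Rightarrow> (nat \<Rightarrow> real) pwfun" where
  "xi_h e \<rho> i j x y = grad e (\<rho> i j x y)"

text \<open>\<open>apply_mat m A \<rho> u\<close> is the piecewise function \<open>A(\<rho>) u\<close>; with \<open>A = F\<close> it is \<open>F\<^sub>h u\<^sub>h\<close> and
  with \<open>A = G\<close> it is \<open>v\<^sub>h\<close>.\<close>

definition apply_mat ::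
    "nat \<Rightarrow> ((nat \<Rightarrow> real) \<Rightarrow> nat \<Rightarrow> nat \<Rightarrow> real) \<Rightarrow> (nat \<Rightarrow> real) pwfun \<Rightarrow> (nat \<Rightarrow> real) pwfun \<Rightarrow>
     (nat \<Rightarrow> real) pwfun" where
  "apply_mat m A \<rho> u i j x y = mat_vec m (A (\<rho> i j x y)) (u i j x y)"

definition xi_flux_x ::
    "mesh \<Rightarrow> ((nat \<Rightarrow> real) \<Rightarrow> real) \<Rightarrow> (nat \<Rightarrow> real) pwfun \<Rightarrow> nat \<Rightarrow> nat \<Rightarrow> real \<Rightarrow> nat \<Rightarrow> real" where
  "xi_flux_x M e \<rho> p j y = mean (x_plus M (xi_h e \<rho>) p j y) (x_minus M (xi_h e \<rho>) p j y)"

definition xi_flux_y ::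
    "mesh \<Rightarrow> ((nat \<Rightarrow> real) \<Rightarrow> real) \<Rightarrow> (nat \<Rightarrow> real) pwfun \<Rightarrow> nat \<Rightarrow> nat \<Rightarrow> real \<Rightarrow> nat \<Rightarrow> real" where
  "xi_flux_y M e \<rho> i q x = mean (y_plus M (xi_h e \<rho>) i q x) (y_minus M (xi_h e \<rho>) i q x)"

definition alpha_x ::
    "mesh \<Rightarrow> nat \<Rightarrow> ((nat \<Rightarrow> real) \<Rightarrow> nat \<Rightarrow> nat \<Rightarrow> real) \<Rightarrow> (nat \<Rightarrow> real) pwfun \<Rightarrow>
     (nat \<Rightarrow> real) pwfun \<Rightarrow> nat \<Rightarrow> nat \<Rightarrow> real \<Rightarrow> real" where
  "alpha_x M m G \<rho> ux p j y =
     max (linf_norm m (x_plus M (apply_mat m G \<rho> ux) p j y))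
         (linf_norm m (x_minus M (apply_mat m G \<rho> ux) p j y))"

definition alpha_y ::
    "mesh \<Rightarrow> nat \<Rightarrow> ((nat \<Rightarrow> real) \<Rightarrow> nat \<Rightarrow> nat \<Rightarrow> real) \<Rightarrow> (nat \<Rightarrow> real) pwfun \<Rightarrow>
     (nat \<Rightarrow> real) pwfun \<Rightarrow> nat \<Rightarrow> nat \<Rightarrow> real \<Rightarrow> real" where
  "alpha_y M m G \<rho> uy i q x =
     max (linf_norm m (y_plus M (apply_mat m G \<rho> uy) i q x))
         (linf_norm m (y_minus M (apply_mat m G \<rho> uy) i q x))"

definition Fu_flux_x ::
    "mesh \<Rightarrow> nat \<Rightarrow> ((nat \<Rightarrow> real) \<Rightarrow> nat \<Rightarrow> nat \<Rightarrow> real) \<Rightarrow> ((nat \<Rightarrow> real) \<Rightarrow> nat \<Rightarrow> nat \<Rightarrow> real) \<Rightarrow>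
     (nat \<Rightarrow> real) pwfun \<Rightarrow> (nat \<Rightarrow> real) pwfun \<Rightarrow> nat \<Rightarrow> nat \<Rightarrow> real \<Rightarrow> nat \<Rightarrow> real" where
  "Fu_flux_x M m F G \<rho> ux p j y =
     (\<lambda>l. mean (x_plus M (apply_mat m F \<rho> ux) p j y) (x_minus M (apply_mat m F \<rho> ux) p j y) l
          + alpha_x M m G \<rho> ux p j y / 2 * (x_plus M \<rho> p j y l - x_minus M \<rho> p j y l))"

definition Fu_flux_y ::
    "mesh \<Rightarrow> nat \<Rightarrow> ((nat \<Rightarrow> real) \<Rightarrow> nat \<Rightarrow> nat \<Rightarrow> real) \<Rightarrow> ((nat \<Rightarrow> real) \<Rightarrow> nat \<Rightarrow> nat \<Rightarrow> real) \<Rightarrow>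
     (nat \<Rightarrow> real) pwfun \<Rightarrow> (nat \<Rightarrow> real) pwfun \<Rightarrow> nat \<Rightarrow> nat \<Rightarrow> real \<Rightarrow> nat \<Rightarrow> real" where
  "Fu_flux_y M m F G \<rho> uy i q x =
     (\<lambda>l. mean (y_plus M (apply_mat m F \<rho> uy) i q x) (y_minus M (apply_mat m F \<rho> uy) i q x) l
          + alpha_y M m G \<rho> uy i q x / 2 * (y_plus M \<rho> i q x l - y_minus M \<rho> i q x l))"

text \<open>
  Derivatives in the quadratures fall on test functions only. These have degree at most \<open>k\<close> on
  each cell and therefore coincide with their interpolants at the Gauss--Lobatto points.
\<close>

definition auxiliary_equation ::
    "mesh \<Rightarrow> nat \<Rightarrow> nat \<Rightarrow> ((nat \<Rightarrow> real) \<Rightarrow> real) \<Rightarrow> (nat \<Rightarrow> real) pwfun \<Rightarrow>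
     (nat \<Rightarrow> real) pwfun \<Rightarrow> (nat \<Rightarrow> real) pwfun \<Rightarrow> bool" where
  "auxiliary_equation M k m e \<rho> ux uy \<longleftrightarrow>
     (\<forall>\<psi>x\<in>dg_vec_space M k m. \<forall>\<psi>y\<in>dg_vec_space M k m. \<forall>i<nx M. \<forall>j<ny M.
        quad_y M k j (\<lambda>y. quad_x M k i (\<lambda>x.
          dot m (ux i j x y) (\<psi>x i j x y) + dot m (uy i j x y) (\<psi>y i j x y))) =
        - quad_y M k j (\<lambda>y. quad_x M k i (\<lambda>x.
            dot m (xi_h e \<rho> i j x y) (\<lambda>l. dx \<psi>x i j x y l + dy \<psi>y i j x y l)))
        + quad_y M k j (\<lambda>y.
            dot m (xi_flux_x M e \<rho> (Suc i) j y) (x_minus M \<psi>x (Suc i) j y)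
            - dot m (xi_flux_x M e \<rho> i j y) (x_plus M \<psi>x i j y))
        + quad_x M k i (\<lambda>x.
            dot m (xi_flux_y M e \<rho> i (Suc j) x) (y_minus M \<psi>y i (Suc j) x)
            - dot m (xi_flux_y M e \<rho> i j x) (y_plus M \<psi>y i j x)))"

definition euler_equation ::
    "mesh \<Rightarrow> nat \<Rightarrow> nat \<Rightarrow> ((nat \<Rightarrow> real) \<Rightarrow> nat \<Rightarrow> nat \<Rightarrow> real) \<Rightarrow>
     ((nat \<Rightarrow> real) \<Rightarrow> nat \<Rightarrow> nat \<Rightarrow> real) \<Rightarrow> real \<Rightarrow> (nat \<Rightarrow> real) pwfun \<Rightarrow>
     (nat \<Rightarrow> real) pwfun \<Rightarrow> (nat \<Rightarrow> real) pwfun \<Rightarrow> (nat \<Rightarrow> real) pwfun \<Rightarrow> bool" where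
  "euler_equation M k m F G \<tau> \<rho> ux uy \<rho>pre \<longleftrightarrow>
     (\<forall>\<phi>\<in>dg_vec_space M k m. \<forall>i<nx M. \<forall>j<ny M.
        quad_y M k j (\<lambda>y. quad_x M k i (\<lambda>x.
          dot m (\<lambda>l. (\<rho>pre i j x y l - \<rho> i j x y l) / \<tau>) (\<phi> i j x y))) =
        - quad_y M k j (\<lambda>y. quad_x M k i (\<lambda>x.
            dot m (apply_mat m F \<rho> ux i j x y) (dx \<phi> i j x y)
            + dot m (apply_mat m F \<rho> uy i j x y) (dy \<phi> i j x y)))
        + quad_y M k j (\<lambda>y.
            dot m (Fu_flux_x M m F G \<rho> ux (Suc i) j y) (x_minus M \<phi> (Suc i) j y)
            - dot m (Fu_flux_x M m F G \<rho> ux i j y) (x_plus M \<phi> i j y))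
        + quad_x M k i (\<lambda>x.
            dot m (Fu_flux_y M m F G \<rho> uy i (Suc j) x) (y_minus M \<phi> i (Suc j) x)
            - dot m (Fu_flux_y M m F G \<rho> uy i j x) (y_plus M \<phi> i j x)))"

text \<open>The nodal values of \<open>\<rho>\<close> are the only states at which \<open>F\<close>, \<open>G\<close> and \<open>grad e\<close> are
  evaluated; they have to be admissible for the scheme to be well-defined.\<close>

definition euler_forward_step ::
    "mesh \<Rightarrow> nat \<Rightarrow> nat \<Rightarrow> (nat \<Rightarrow> real) set \<Rightarrow> ((nat \<Rightarrow> real) \<Rightarrow> real) \<Rightarrow>
     ((nat \<Rightarrow> real) \<Rightarrow> nat \<Rightarrow> nat \<Rightarrow> real) \<Rightarrow> ((nat \<Rightarrow> real) \<Rightarrow> nat \<Rightarrow> nat \<Rightarrow> real) \<Rightarrow> real \<Rightarrow>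
     (nat \<Rightarrow> real) pwfun \<Rightarrow> (nat \<Rightarrow> real) pwfun \<Rightarrow> (nat \<Rightarrow> real) pwfun \<Rightarrow>
     (nat \<Rightarrow> real) pwfun \<Rightarrow> bool" where
  "euler_forward_step M k m S e F G \<tau> \<rho> ux uy \<rho>pre \<longleftrightarrow>
     0 < \<tau> \<and>
     \<rho> \<in> dg_vec_space M k m \<and>
     (\<forall>i<nx M. \<forall>j<ny M. \<forall>r\<le>k. \<forall>s\<le>k. \<rho> i j (x_node M k i r) (y_node M k j s) \<in> S) \<and>
     ux \<in> dg_vec_space M k m \<and> uy \<in> dg_vec_space M k m \<and> auxiliary_equation M k m e \<rho> ux uy \<and>
     \<rho>pre \<in> dg_vec_space M k m \<and> euler_equation M k m F G \<tau> \<rho> ux uy \<rho>pre"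

definition quot_top :: "real \<Rightarrow> real \<Rightarrow> ereal" where
  "quot_top a b = (if b = 0 then \<infinity> else ereal (a / b))"

definition time_step_bound ::
    "mesh \<Rightarrow> nat \<Rightarrow> nat \<Rightarrow> ((nat \<Rightarrow> real) \<Rightarrow> nat \<Rightarrow> nat \<Rightarrow> real) \<Rightarrow> (nat \<Rightarrow> real) pwfun \<Rightarrow>
     (nat \<Rightarrow> real) pwfun \<Rightarrow> (nat \<Rightarrow> real) pwfun \<Rightarrow> nat \<Rightarrow> ereal" where
  "time_step_bound M k m G \<rho> ux uy l =
     ereal (1 / 2) *
     (INF (i, j, r, s) \<in> {..<nx M} \<times> {..<ny M} \<times> {..k} \<times> {..k}.
        let x = x_node M k i r; y = y_node M k j s in
        Min {quot_top (gl_weight k 0 * hx M i)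
               (alpha_x M m G \<rho> ux i j y + x_plus M (apply_mat m G \<rho> ux) i j y l),
             quot_top (gl_weight k k * hx M i)
               (alpha_x M m G \<rho> ux (Suc i) j y - x_minus M (apply_mat m G \<rho> ux) (Suc i) j y l),
             quot_top (gl_weight k 0 * hy M j)
               (alpha_y M m G \<rho> uy i j x + y_plus M (apply_mat m G \<rho> uy) i j x l),
             quot_top (gl_weight k k * hy M j)
               (alpha_y M m G \<rho> uy i (Suc j) x - y_minus M (apply_mat m G \<rho> uy) i (Suc j) x l)})"

text \<open>Cells are open. For a continuous function, the supremum over a cell is the maximum over
  its closure.\<close>

definition cell :: "mesh \<Rightarrow> nat \<Rightarrow> nat \<Rightarrow> (real \<times> real) set" where
  "cell M i j = {xp M i<..<xp M (Suc i)} \<times> {yp M j<..<yp M (Suc j)}"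

definition cell_average :: "mesh \<Rightarrow> real pwfun \<Rightarrow> nat \<Rightarrow> nat \<Rightarrow> real" where
  "cell_average M v i j = integral (cell M i j) (\<lambda>(x, y). v i j x y) / (hx M i * hy M j)"

definition nodal_min :: "mesh \<Rightarrow> nat \<Rightarrow> real pwfun \<Rightarrow> nat \<Rightarrow> nat \<Rightarrow> real" where
  "nodal_min M k v i j =
     Min ((\<lambda>(r, s). v i j (x_node M k i r) (y_node M k j s)) ` ({..k} \<times> {..k}))"

definition limiter_theta :: "mesh \<Rightarrow> nat \<Rightarrow> real pwfun \<Rightarrow> nat \<Rightarrow> nat \<Rightarrow> real" where
  "limiter_theta M k v i j =
     (if cell_average M v i j = nodal_min M k v i j then 1
      else min (cell_average M v i j / (cell_average M v i j - nodal_min M k v i j)) 1)"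

definition limited :: "mesh \<Rightarrow> nat \<Rightarrow> real pwfun \<Rightarrow> real pwfun \<Rightarrow> bool" where
  "limited M k v w \<longleftrightarrow> w \<in> dg_space M k \<and>
     (\<forall>i<nx M. \<forall>j<ny M. \<forall>r\<le>k. \<forall>s\<le>k.
        w i j (x_node M k i r) (y_node M k j s) =
          cell_average M v i j + limiter_theta M k v i j *
            (v i j (x_node M k i r) (y_node M k j s) - cell_average M v i j))"

end

theory Submission
  imports Defs
begin

text \<open>
  Testing the Euler step with a constant expresses the new cell average by the old one and the
  interface fluxes. As \<open>F = diag \<rho> G\<close>, each flux is a difference \<open>\<rho>\<^sup>+ (\<alpha> + v\<^sup>+) / 2 - \<rho>\<^sup>- (\<alpha> - v\<^sup>-) / 2\<close>
  of two non-negative terms, and under the time step restriction the outflow through the vertical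
  (horizontal) interfaces of a cell is at most the contribution of the end point nodes to one half
  of the old average. This needs positive Gauss--Lobatto weights and the exactness of the
  quadrature for degree \<open>k\<close>.

  The limiter moves nodal values by \<open>(1 - \<theta>) \<bar>\<rho> - a\<bar>\<close>, \<open>a\<close> being the cell average. Positivity
  of the weights bounds \<open>\<bar>\<rho> - a\<bar>\<close> by a multiple of \<open>a - min \<rho>\<close>, and \<open>(1 - \<theta>) (a - min \<rho>)\<close> is the
  negative part of \<open>min \<rho>\<close>, which is at most the error because the exact solution is non-negative.
\<close>

subsection \<open>Gauss--Lobatto quadrature\<close>

definition pint :: "real poly \<Rightarrow> real" where
  "pint p = integral {-1..1} (poly p)"

lemma poly_integrable_on [simp, intro]: "poly (p :: real poly) integrable_on {a..b}"
  by (intro integrable_continuous_interval continuous_intros)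

lemma pint_add: "pint (p + q) = pint p + pint q"
  unfolding pint_def poly_add by (rule integral_add) auto

lemma pint_smult: "pint (smult c p) = c * pint p"
  unfolding pint_def poly_smult by simp

lemma pint_0 [simp]: "pint 0 = 0"
  using pint_smult[of 0 0] by simp

lemma pint_sum: "finite A \<Longrightarrow> pint (\<Sum>a\<in>A. f a) = (\<Sum>a\<in>A. pint (f a))"
  by (induction A rule: finite_induct) (simp_all add: pint_add)

lemma pint_pderiv: "pint (pderiv p) = poly p 1 - poly p (-1)"
proof -
  have "(poly (pderiv p) has_integral (poly p 1 - poly p (-1))) {-1..1}"
    by (rule fundamental_theorem_of_calculus)
       (auto simp flip: has_real_derivative_iff_has_vector_derivative
             intro: has_field_derivative_at_within poly_DERIV)
  then show ?thesis
    by (simp add: pint_def integral_unique)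
qed

lemma pint_by_parts:
  "pint (pderiv p * q) = poly (p * q) 1 - poly (p * q) (-1) - pint (p * pderiv q)"
  using pint_pderiv[of "p * q"] pint_add[of "p * pderiv q" "q * pderiv p"]
  by (simp add: pderiv_mult mult.commute)

text \<open>A continuous non-negative function with integral zero vanishes on the whole interval,
  which \<open>t0\<close> excludes.\<close>

lemma pint_pos:
  assumes "\<And>t. t \<in> {-1..1} \<Longrightarrow> 0 \<le> poly p t" "t0 \<in> {-1..1}" "poly p t0 \<noteq> 0"
  shows "0 < pint p"
proof -
  have "pint p \<ge> 0"
    unfolding pint_def by (rule integral_nonneg) (use assms in auto)
  moreover have "pint p \<noteq> 0"
    unfolding pint_def
    by (subst integral_eq_0_iff) (use assms in \<open>auto intro!: continuous_intros\<close>)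
  ultimately show ?thesis by simp
qed

text \<open>Rolle's theorem with counting. The induction removes the largest zero; the mean value
  theorem between the two largest zeros gives a zero of the derivative to the right of those already
  found. The new zeros lie in the open interval, so that end points can later be adjoined without
  overlap.\<close>

lemma card_pderiv_roots:
  fixes p :: "real poly"
  assumes "finite A" "card A = Suc n" "A \<subseteq> {a..b}" "\<And>x. x \<in> A \<Longrightarrow> poly p x = 0"
  shows "\<exists>B. finite B \<and> card B = n \<and> B \<subseteq> {a<..<b} \<and> (\<forall>x\<in>B. poly (pderiv p) x = 0)"
  using assms
proof (induction n arbitrary: A b)
  case 0
  then show ?case by (intro exI[of _ "{}"]) auto
next
  case (Suc n)
  define c where "c = Max A"
  define A' where "A' = A - {c}"
  define d where "d = Max A'"
  have "A \<noteq> {}" using Suc.prems by auto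
  then have c: "c \<in> A" unfolding c_def using Suc.prems by auto
  have A': "finite A'" "card A' = Suc n"
    using Suc.prems c by (auto simp: A'_def)
  then have "A' \<noteq> {}" by auto
  have d: "d \<in> A'" unfolding d_def using A' \<open>A' \<noteq> {}\<close> by auto
  have "d < c"
    using d Suc.prems(1) unfolding A'_def c_def by (auto simp: less_le)
  have "A' \<subseteq> {a..d}"
  proof
    fix x assume "x \<in> A'"
    then show "x \<in> {a..d}"
      using Max_ge[OF A'(1)] Suc.prems(3) by (auto simp: d_def A'_def)
  qed
  with Suc.IH[of A' d] A' Suc.prems obtain B
    where B: "finite B" "card B = n" "B \<subseteq> {a<..<d}" "\<forall>x\<in>B. poly (pderiv p) x = 0"
    unfolding A'_def by auto
  obtain z where z: "d < z" "z < c" "poly p c - poly p d = (c - d) * poly (pderiv p) z"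
    using poly_MVT[OF \<open>d < c\<close>] by blast
  have "poly (pderiv p) z = 0"
    using z Suc.prems(4) c d \<open>d < c\<close> by (auto simp: A'_def)
  moreover have "a \<le> d" "c \<le> b"
    using c d Suc.prems(3) by (auto simp: A'_def)
  ultimately show ?case
    using B z by (intro exI[of _ "insert z B"]) (auto simp: card_insert_if)
qed

section \<open>Zeros and orthogonality of the Legendre polynomials\<close>

lemma power_dvd_pderiv:
  fixes p r :: "real poly"
  assumes "r ^ Suc n dvd p"
  shows "r ^ n dvd pderiv p"
proof -
  obtain q where "p = r ^ Suc n * q" using assms by auto
  then have "pderiv p = r ^ n * (r * pderiv q + smult (of_nat (Suc n)) (pderiv r * q))"
    by (simp only: pderiv_mult pderiv_power_Suc) (simp add: algebra_simps)
  then show ?thesis by simp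
qed

lemma degree_higher_pderiv:
  "degree ((pderiv ^^ j) (p :: real poly)) = degree p - j"
  by (induction j) (simp_all add: degree_pderiv)

abbreviation leg_base :: "real poly" where
  "leg_base \<equiv> [:-1, 0, 1:]"

lemma poly_leg_base: "poly leg_base t = t\<^sup>2 - 1"
  by (simp add: power2_eq_square)

text \<open>Both end points are zeros of multiplicity \<open>k\<close> of the power, and every
  derivative costs at most one multiplicity.\<close>

lemma poly_higher_pderiv_leg_base:
  assumes "j < k" "t\<^sup>2 = 1"
  shows "poly ((pderiv ^^ j) (leg_base ^ k)) t = 0"
proof -
  have "leg_base ^ (k - j) dvd (pderiv ^^ j) (leg_base ^ k)" if "j \<le> k"
    using that
  proof (induction j)
    case (Suc j)
    then have "leg_base ^ Suc (k - Suc j) dvd (pderiv ^^ j) (leg_base ^ k)"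
      by (simp add: Suc_diff_Suc del: power_Suc)
    then show ?case by (simp add: power_dvd_pderiv del: power_Suc)
  qed simp
  then obtain q where "(pderiv ^^ j) (leg_base ^ k) = leg_base ^ (k - j) * q"
    using assms by auto
  then show ?thesis
    using assms by (simp add: poly_leg_base poly_power del: poly_pCons)
qed

text \<open>Before the \<open>k\<close>-th derivative, the end points -1 and 1 are zeros besides the
  \<open>j\<close> interior ones. Rolle's theorem on these \<open>j + 2\<close> zeros yields
  \<open>j + 1\<close> interior zeros of the next derivative.\<close>

lemma legendre_roots_aux:
  assumes "j \<le> k"
  shows "\<exists>B. finite B \<and> card B = j \<and> B \<subseteq> {-1<..<1} \<and>
           (\<forall>x\<in>B. poly ((pderiv ^^ j) (leg_base ^ k)) x = 0)"
  using assms
proof (induction j)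
  case (Suc j)
  then obtain B where B: "finite B" "card B = j" "B \<subseteq> {-1<..<1}"
      "\<forall>x\<in>B. poly ((pderiv ^^ j) (leg_base ^ k)) x = 0"
    by auto
  have "\<exists>B'. finite B' \<and> card B' = Suc j \<and> B' \<subseteq> {-1<..<1} \<and>
          (\<forall>x\<in>B'. poly (pderiv ((pderiv ^^ j) (leg_base ^ k))) x = 0)"
  proof (rule card_pderiv_roots)
    have "- 1 \<notin> insert 1 B" "1 \<notin> B" using B(3) by auto
    then show "card (insert (- 1) (insert 1 B)) = Suc (Suc j)"
      using B by simp
  qed (use B Suc in \<open>auto simp: poly_higher_pderiv_leg_base\<close>)
  then show ?case by simp
qed (auto intro!: exI[of _ "{}"])

lemma degree_legendre: "degree (legendre k) = k"
  by (simp add: legendre_def degree_higher_pderiv degree_power_eq)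

text \<open>Repeated integration by parts moves the derivatives of Rodrigues' formula onto
  \<open>q\<close> until \<open>q\<close> is differentiated away; the boundary terms vanish by the
  multiplicity of the end points.\<close>

lemma pint_legendre_mult:
  assumes "degree q < k"
  shows "pint (legendre k * q) = 0"
proof -
  have "pint ((pderiv ^^ j) (leg_base ^ k) * q) = 0" if "j \<le> k" "degree q < j" for j q
    using that
  proof (induction j arbitrary: q)
    case (Suc j)
    have "pint ((pderiv ^^ j) (leg_base ^ k) * pderiv q) = 0"
    \<comment> \<open>For constant \<open>q\<close> the degree cannot drop further, so the induction
      hypothesis may be out of reach; but then the derivative of \<open>q\<close> is zero.\<close>
    proof (cases "degree q = 0")
      case True
      then show ?thesis by (simp add: pderiv_eq_0_iff [THEN iffD2])
    next
      case False
      with Suc show ?thesis by (auto simp: degree_pderiv)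
    qed
    moreover have "poly ((pderiv ^^ j) (leg_base ^ k)) 1 = 0"
        "poly ((pderiv ^^ j) (leg_base ^ k)) (- 1) = 0"
      by (rule poly_higher_pderiv_leg_base; use Suc in simp)+
    ultimately show ?case
      by (simp add: pint_by_parts)
  qed simp
  then show ?thesis
    using assms by (simp add: legendre_def pint_smult)
qed

section \<open>Gauss--Lobatto nodes\<close>

definition gl_set :: "nat \<Rightarrow> real set" where
  "gl_set k = {-1, 1} \<union> {t. poly (pderiv (legendre k)) t = 0}"

lemma pderiv_legendre_nonzero: "1 \<le> k \<Longrightarrow> pderiv (legendre k) \<noteq> 0"
  by (simp add: pderiv_eq_0_iff degree_legendre)

text \<open>Rolle's theorem provides \<open>k - 1\<close> zeros of the derivative of the Legendre
  polynomial inside (-1, 1), and its degree allows no others. Hence all its real zeros are interior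
  and simple to enumerate together with the two end points.\<close>

lemma gl_set:
  assumes "1 \<le> k"
  shows "finite (gl_set k)" "card (gl_set k) = Suc k" "gl_set k \<subseteq> {-1..1}"
proof -
  define R where "R = {t. poly (pderiv (legendre k)) t = 0}"
  have fin: "finite R"
    unfolding R_def using assms by (intro poly_roots_finite pderiv_legendre_nonzero)
  obtain B where B: "finite B" "card B = k" "B \<subseteq> {-1<..<1}"
      "\<forall>x\<in>B. poly ((pderiv ^^ k) (leg_base ^ k)) x = 0"
    using legendre_roots_aux[of k k] by auto
  have "\<exists>D. finite D \<and> card D = k - 1 \<and> D \<subseteq> {-1<..<1} \<and>
          (\<forall>x\<in>D. poly (pderiv ((pderiv ^^ k) (leg_base ^ k))) x = 0)"
    by (rule card_pderiv_roots[of B]) (use B assms in \<open>auto simp: less_imp_le\<close>)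
  then obtain D where D: "finite D" "card D = k - 1" "D \<subseteq> {-1<..<1}"
      "\<forall>x\<in>D. poly (pderiv ((pderiv ^^ k) (leg_base ^ k))) x = 0"
    by auto
  have "D \<subseteq> R"
    using D(4) by (auto simp: R_def legendre_def pderiv_smult)
  moreover have "card R \<le> k - 1"
    unfolding R_def using card_poly_roots_bound[OF pderiv_legendre_nonzero[OF assms]]
    by (simp add: degree_pderiv degree_legendre)
  ultimately have "D = R"
    using D fin by (intro card_seteq) auto
  then have "gl_set k = insert (-1) (insert 1 D)"
    by (auto simp: gl_set_def R_def)
  moreover have "- 1 \<notin> insert 1 D" "1 \<notin> D" using D(3) by auto
  ultimately show "finite (gl_set k)" "card (gl_set k) = Suc k" "gl_set k \<subseteq> {-1..1}"
    using D assms by auto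
qed

lemma gl_node_bij:
  assumes "1 \<le> k"
  shows "bij_betw (gl_node k) {..k} (gl_set k)"
proof -
  have "bij_betw ((!) (sorted_list_of_set (gl_set k))) {..<Suc k} (gl_set k)"
    by (rule bij_betw_nth) (use gl_set[OF assms] in auto)
  then show ?thesis
    by (simp add: gl_node_def [abs_def] gl_set_def lessThan_Suc_atMost)
qed

lemma gl_node_eq_iff:
  "1 \<le> k \<Longrightarrow> r \<le> k \<Longrightarrow> s \<le> k \<Longrightarrow> gl_node k r = gl_node k s \<longleftrightarrow> r = s"
  using gl_node_bij[of k] by (auto simp: bij_betw_def inj_on_def)

lemma gl_node_in: "1 \<le> k \<Longrightarrow> r \<le> k \<Longrightarrow> gl_node k r \<in> gl_set k"
  using gl_node_bij[of k] by (auto simp: bij_betw_def)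

lemma gl_node_bounds:
  assumes "1 \<le> k" "r \<le> k"
  shows "-1 \<le> gl_node k r" "gl_node k r \<le> 1"
  using gl_node_in[OF assms] gl_set(3)[OF assms(1)] by auto

lemma gl_node_mono:
  assumes "1 \<le> k" "r \<le> s" "s \<le> k"
  shows "gl_node k r \<le> gl_node k s"
  unfolding gl_node_def gl_set_def[symmetric]
  by (rule sorted_nth_mono) (use gl_set[OF assms(1)] assms in auto)

lemma gl_node_surj:
  assumes "1 \<le> k" "t \<in> gl_set k"
  obtains r where "r \<le> k" "gl_node k r = t"
proof -
  have "t \<in> gl_node k ` {..k}"
    using gl_node_bij[OF assms(1)] assms(2) by (simp add: bij_betw_def)
  then show ?thesis using that by auto
qed

lemma gl_node_first: "1 \<le> k \<Longrightarrow> gl_node k 0 = -1"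
  and gl_node_last: "1 \<le> k \<Longrightarrow> gl_node k k = 1"
proof -
  assume k: "1 \<le> k"
  obtain r where r: "r \<le> k" "gl_node k r = -1"
    using gl_node_surj[OF k, of "-1"] by (auto simp: gl_set_def)
  show "gl_node k 0 = -1"
    using gl_node_mono[OF k, of 0 r] r gl_node_bounds[OF k, of 0] by auto
  obtain s where s: "s \<le> k" "gl_node k s = 1"
    using gl_node_surj[OF k, of 1] by (auto simp: gl_set_def)
  show "gl_node k k = 1"
    using gl_node_mono[OF k, of s k] s gl_node_bounds[OF k, of k] by auto
qed

section \<open>Lagrange basis, exactness and positivity of the weights\<close>

definition gl_lagrange :: "nat \<Rightarrow> nat \<Rightarrow> real poly" where
  "gl_lagrange k r =
     (\<Prod>s\<in>{..k} - {r}. smult (1 / (gl_node k r - gl_node k s)) [:- gl_node k s, 1:])"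

text \<open>Links the polynomial, on which degrees can be counted, to the integrand in
  \<open>gl_weight\<close>.\<close>

lemma poly_gl_lagrange:
  "poly (gl_lagrange k r) t =
     (\<Prod>s\<in>{..k} - {r}. (t - gl_node k s) / (gl_node k r - gl_node k s))"
  by (simp add: gl_lagrange_def poly_prod diff_divide_distrib)

lemma poly_gl_lagrange_node:
  assumes "1 \<le> k" "r \<le> k" "s \<le> k"
  shows "poly (gl_lagrange k r) (gl_node k s) = (if s = r then 1 else 0)"
proof (cases "s = r")
  case True
  then show ?thesis
    using assms by (auto simp: poly_gl_lagrange gl_node_eq_iff intro!: prod.neutral)
next
  case False
  then show ?thesis
    using assms by (auto simp: poly_gl_lagrange intro!: bexI[of _ s])
qed

lemma degree_gl_lagrange:
  assumes "r \<le> k"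
  shows "degree (gl_lagrange k r) \<le> k"
proof -
  have "degree (smult c [:- gl_node k s, 1:]) \<le> 1" for c s
    by (rule order_trans[OF degree_smult_le]) simp
  then have "degree (gl_lagrange k r) \<le> (\<Sum>s\<in>{..k} - {r}. 1)"
    unfolding gl_lagrange_def
    by (intro order_trans[OF degree_prod_sum_le] sum_mono) (simp_all only: o_def finite_Diff finite_atMost)
  then show ?thesis using assms by simp
qed

lemma gl_weight_eq_pint: "gl_weight k r = pint (gl_lagrange k r)"
  by (simp add: gl_weight_def pint_def poly_gl_lagrange [abs_def])

text \<open>Both sides have degree at most \<open>k\<close> and agree at \<open>k + 1\<close>
  points.\<close>

lemma gl_interpolation:
  assumes "1 \<le> k" "degree p \<le> k"
  shows "p = (\<Sum>r\<le>k. smult (poly p (gl_node k r)) (gl_lagrange k r))"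
proof (rule poly_eqI_degree)
  fix t assume "t \<in> gl_set k"
  then obtain r where r: "r \<le> k" "gl_node k r = t"
    using gl_node_surj assms by blast
  have "poly (\<Sum>r\<le>k. smult (poly p (gl_node k r)) (gl_lagrange k r)) t =
      (\<Sum>s\<le>k. if s = r then poly p (gl_node k r) else 0)"
    unfolding poly_sum using r assms
    by (intro sum.cong) (auto simp: poly_gl_lagrange_node simp flip: r(2))
  then show "poly p t = poly (\<Sum>r\<le>k. smult (poly p (gl_node k r)) (gl_lagrange k r)) t"
    using r by simp
next
  have "degree (\<Sum>r\<le>k. smult (poly p (gl_node k r)) (gl_lagrange k r)) \<le> k"
    by (intro degree_sum_le) (auto intro: order_trans[OF degree_smult_le] degree_gl_lagrange)
  then show "card (gl_set k) > degree (\<Sum>r\<le>k. smult (poly p (gl_node k r)) (gl_lagrange k r))"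
    using gl_set assms by simp
qed (use gl_set assms in simp)

text \<open>Since \<open>(t\<^sup>2 - 1) P'\<close>, with \<open>P\<close> the Legendre polynomial, vanishes at all nodes, reduction
  modulo this polynomial changes neither the quadrature sum nor, by orthogonality, the integral.\<close>

lemma gl_exact:
  assumes k: "1 \<le> k" and deg: "degree p < 2 * k"
  shows "pint p = (\<Sum>r\<le>k. gl_weight k r * poly p (gl_node k r))"
proof -
  define N where "N = leg_base * pderiv (legendre k)"
  have Q: "pderiv (legendre k) \<noteq> 0" using k by (rule pderiv_legendre_nonzero)
  then have N: "N \<noteq> 0" "degree N = Suc k"
    using k degree_mult_eq[of leg_base, OF _ Q]
    by (auto simp: N_def degree_pderiv degree_legendre simp del: mult_pCons_left)
  define q where "q = p div N"
  define g where "g = p mod N"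
  have p: "p = N * q + g" by (simp add: q_def g_def)
  have g: "degree g \<le> k"
    using degree_mod_less[of N p] N by (auto simp: g_def)
  have N0: "poly N (gl_node k r) = 0" if "r \<le> k" for r
    using gl_node_in[OF k that] by (auto simp: gl_set_def N_def)
  have "pint (N * q) = 0"
  proof (cases "q = 0")
    case False
    \<comment> \<open>The product \<open>N * q\<close> has degree below \<open>2 * k\<close> and
      \<open>N\<close> has degree \<open>k + 1\<close>, which leaves at most \<open>k - 2\<close>
      for \<open>q\<close>.\<close>
    have dq: "degree q + 1 < k"
    proof -
      have "degree (N * q) \<le> max (degree p) (degree g)"
        using p degree_diff_le_max[of p g] by (simp add: q_def g_def minus_mod_eq_mult_div)
      then show ?thesis using N g deg k False by (simp add: degree_mult_eq)
    qed
    have "degree (pderiv (leg_base * q)) < k"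
      using dq False degree_mult_eq[of leg_base q] by (simp add: degree_pderiv del: mult_pCons_left)
    then have "pint (legendre k * pderiv (leg_base * q)) = 0"
      by (rule pint_legendre_mult)
    \<comment> \<open>The boundary terms vanish because \<open>leg_base\<close> is zero at -1 and
      1.\<close>
    then have "pint (pderiv (legendre k) * (leg_base * q)) = 0"
      by (subst pint_by_parts) simp
    then show ?thesis unfolding N_def by (metis mult.assoc mult.commute)
  qed simp
  then have "pint p = pint g" by (subst p) (simp add: pint_add)
  also have "\<dots> = (\<Sum>r\<le>k. gl_weight k r * poly g (gl_node k r))"
    by (subst gl_interpolation[OF k g]) (simp add: pint_sum pint_smult gl_weight_eq_pint mult.commute)
  also have "\<dots> = (\<Sum>r\<le>k. gl_weight k r * poly p (gl_node k r))"
    using p by (intro sum.cong refl) (metis N0 add_0 atMost_iff mult_zero_left poly_add poly_mult)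
  finally show ?thesis .
qed

text \<open>The square of the Lagrange polynomial would have degree \<open>2 k\<close>, one more than the quadrature
  integrates exactly; dropping one of the two factors belonging to an end point keeps the sign.\<close>

lemma gl_weight_pos:
  assumes k: "1 \<le> k" and r: "r \<le> k"
  shows "0 < gl_weight k r"
proof -
  \<comment> \<open>\<open>s0\<close> is an end point node different from \<open>r\<close>, and the
    sign \<open>e\<close> makes \<open>e * (t - gl_node k s0)\<close> non-negative on
    [-1, 1].\<close>
  define s0 where "s0 = (if r = 0 then k else 0)"
  define e where "e = (if r = 0 then -1 else 1 :: real)"
  define h where "h = (\<Prod>s\<in>{..k} - {r, s0}. [:- gl_node k s, 1:])"
  define g where "g = smult e ([:- gl_node k s0, 1:] * h\<^sup>2)"
  have s0: "s0 \<le> k" "s0 \<noteq> r" using k by (auto simp: s0_def)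
  have h: "poly h t = (\<Prod>s\<in>{..k} - {r, s0}. t - gl_node k s)" for t
    by (simp add: h_def poly_prod)
  have "degree h \<le> (\<Sum>s\<in>{..k} - {r, s0}. 1)"
    unfolding h_def by (rule order_trans[OF degree_prod_sum_le]) (auto intro!: sum_mono)
  also have "\<dots> = k - 1"
    using r s0 by (simp add: card_Diff_subset)
  finally have "degree (h\<^sup>2) \<le> 2 * (k - 1)"
    using degree_power_le[of h 2] by simp
  moreover have "degree g \<le> 1 + degree (h\<^sup>2)"
    unfolding g_def by (rule order_trans[OF degree_smult_le order_trans[OF degree_mult_le]]) simp
  ultimately have deg: "degree g < 2 * k" using k by simp
  have g: "poly g t = e * (t - gl_node k s0) * (poly h t)\<^sup>2" for t
    by (simp add: g_def poly_power algebra_simps)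
  have g0: "poly g (gl_node k s) = 0" if "s \<le> k" "s \<noteq> r" for s
  proof (cases "s = s0")
    case False
    then have "poly h (gl_node k s) = 0"
      unfolding h using that by (intro prod_zero) auto
    then show ?thesis by (simp add: g)
  qed (simp add: g)
  have nonneg: "0 \<le> poly g t" if "t \<in> {-1..1}" for t
    using that k unfolding g e_def s0_def
    by (auto simp: gl_node_first gl_node_last intro!: mult_nonneg_nonneg)
  have "poly h (gl_node k r) \<noteq> 0"
    unfolding h using k r by (auto simp: gl_node_eq_iff)
  then have nz: "poly g (gl_node k r) \<noteq> 0"
    using k r s0 by (auto simp: g e_def gl_node_eq_iff)
  have in_ivl: "gl_node k r \<in> {-1..1}" using gl_node_bounds[OF k r] by auto
  have "0 < pint g"
    using nonneg in_ivl nz by (rule pint_pos)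
  \<comment> \<open>The degree of \<open>g\<close> is at most \<open>2 * k - 1\<close>, so the
    quadrature is exact, and only the node \<open>r\<close> contributes to it.\<close>
  also have "pint g = (\<Sum>s\<le>k. if s = r then gl_weight k r * poly g (gl_node k r) else 0)"
    unfolding gl_exact[OF k deg] by (intro sum.cong) (auto simp: g0)
  also have "\<dots> = gl_weight k r * poly g (gl_node k r)"
    using r by simp
  finally show ?thesis
    using nonneg[OF in_ivl] nz by (simp add: zero_less_mult_iff)
qed

lemma sum_gl_weight: "1 \<le> k \<Longrightarrow> (\<Sum>r\<le>k. gl_weight k r) = 2"
  using gl_exact[of k 1] by (simp add: pint_def poly_1 [abs_def])

subsection \<open>Tensor product polynomials on a cell\<close>

lemma x_node_first: "1 \<le> k \<Longrightarrow> x_node M k i 0 = xp M i"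
  and x_node_last: "1 \<le> k \<Longrightarrow> x_node M k i k = xp M (Suc i)"
  and y_node_first: "1 \<le> k \<Longrightarrow> y_node M k j 0 = yp M j"
  and y_node_last: "1 \<le> k \<Longrightarrow> y_node M k j k = yp M (Suc j)"
  by (simp_all add: x_node_def y_node_def hx_def hy_def gl_node_first gl_node_last field_simps)

lemma hx_pos: "wf_mesh M \<Longrightarrow> i < nx M \<Longrightarrow> 0 < hx M i"
  and hy_pos: "wf_mesh M \<Longrightarrow> j < ny M \<Longrightarrow> 0 < hy M j"
  by (simp_all add: wf_mesh_def hx_def hy_def)

lemma affine_node_bounds:
  fixes a b :: real
  assumes "1 \<le> k" "r \<le> k" "a < b"
  shows "(a + b) / 2 + (b - a) / 2 * gl_node k r \<in> {a..b}"
proof -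
  have "(b - a) / 2 * gl_node k r \<le> (b - a) / 2 * 1" "(b - a) / 2 * (-1) \<le> (b - a) / 2 * gl_node k r"
    by (intro mult_left_mono; use assms gl_node_bounds[of k r] in simp)+
  then show ?thesis by (simp add: field_simps)
qed

lemma affine_interpolation:
  fixes a b :: real
  assumes k: "1 \<le> k" and p: "degree p \<le> k" and ab: "a < b"
  shows "poly p x = (\<Sum>r\<le>k. poly p ((a + b) / 2 + (b - a) / 2 * gl_node k r) *
           poly (gl_lagrange k r) ((2 * x - (a + b)) / (b - a)))"
proof -
  \<comment> \<open>\<open>A\<close> maps [-1, 1] onto [a, b] and \<open>t\<close> is the preimage
    of \<open>x\<close>, so the claim is interpolation of \<open>p\<close> composed with
    \<open>A\<close>.\<close>
  define A where "A = [:(a + b) / 2, (b - a) / 2:]"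
  define t where "t = (2 * x - (a + b)) / (b - a)"
  have "degree (pcompose p A) \<le> k"
    using order_trans[OF degree_pcompose_le[of p A]] p ab by (simp add: A_def)
  from arg_cong[where f = "\<lambda>p. poly p t", OF gl_interpolation[OF k this]]
  have "poly (pcompose p A) t =
      (\<Sum>r\<le>k. poly (pcompose p A) (gl_node k r) * poly (gl_lagrange k r) t)"
    unfolding poly_sum poly_smult .
  moreover have "poly A t = x" "\<And>s. poly A s = (a + b) / 2 + (b - a) / 2 * s"
    using ab by (simp_all add: A_def t_def field_simps)
  ultimately show ?thesis by (simp add: poly_pcompose t_def)
qed

text \<open>The interpolation formula is integrated term by term. Each transplanted Lagrange
  polynomial contributes its weight times half the interval length, by an affine
  substitution.\<close>

lemma poly_integral_quadrature:
  fixes a b :: real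
  assumes k: "1 \<le> k" and p: "degree p \<le> k" and ab: "a < b"
  shows "integral {a..b} (poly p) =
           (b - a) / 2 * (\<Sum>r\<le>k. gl_weight k r * poly p ((a + b) / 2 + (b - a) / 2 * gl_node k r))"
proof -
  have L: "((\<lambda>x. poly (gl_lagrange k r) ((2 * x - (a + b)) / (b - a))) has_integral
           (b - a) / 2 * gl_weight k r) {a..b}" for r
  proof -
    define m where "m = 2 / (b - a)"
    define c where "c = - (a + b) / (b - a)"
    have "(poly (gl_lagrange k r) has_integral gl_weight k r) (cbox (-1) 1)"
      by (simp add: gl_weight_eq_pint pint_def integrable_integral)
    from has_integral_affinity'[OF this, of m c]
    have "((\<lambda>x. poly (gl_lagrange k r) (m * x + c)) has_integral gl_weight k r /\<^sub>R m)
           (cbox ((-1 - c) /\<^sub>R m) ((1 - c) /\<^sub>R m))"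
      using ab by (simp add: m_def)
    moreover have "(-1 - c) /\<^sub>R m = a" "(1 - c) /\<^sub>R m = b"
        "gl_weight k r /\<^sub>R m = (b - a) / 2 * gl_weight k r"
      using ab by (simp_all add: m_def c_def field_simps)
    moreover have "m * x + c = (2 * x - (a + b)) / (b - a)" for x
      by (simp add: m_def c_def diff_divide_distrib add_divide_distrib)
    ultimately show ?thesis by (simp only: interval_cbox)
  qed
  have "((\<lambda>x. \<Sum>r\<le>k. poly p ((a + b) / 2 + (b - a) / 2 * gl_node k r) *
           poly (gl_lagrange k r) ((2 * x - (a + b)) / (b - a))) has_integral
         (\<Sum>r\<le>k. poly p ((a + b) / 2 + (b - a) / 2 * gl_node k r) * ((b - a) / 2 * gl_weight k r))) {a..b}"
    by (intro has_integral_sum has_integral_mult_right L) auto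
  then have "(poly p has_integral
         (\<Sum>r\<le>k. poly p ((a + b) / 2 + (b - a) / 2 * gl_node k r) * ((b - a) / 2 * gl_weight k r))) {a..b}"
    by (simp only: affine_interpolation[OF k p ab, symmetric])
  then show ?thesis
    by (simp add: integral_unique sum_distrib_left mult_ac)
qed

lemma quad_x_poly:
  assumes "1 \<le> k" "wf_mesh M" "i < nx M" "degree p \<le> k"
  shows "integral {xp M i..xp M (Suc i)} (poly p) = quad_x M k i (poly p)"
  using poly_integral_quadrature[of k p "xp M i" "xp M (Suc i)"] hx_pos[of M i] assms
  by (simp add: quad_x_def x_node_def hx_def)

lemma quad_y_poly:
  assumes "1 \<le> k" "wf_mesh M" "j < ny M" "degree p \<le> k"
  shows "integral {yp M j..yp M (Suc j)} (poly p) = quad_y M k j (poly p)"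
  using poly_integral_quadrature[of k p "yp M j" "yp M (Suc j)"] hy_pos[of M j] assms
  by (simp add: quad_y_def y_node_def hy_def)

section \<open>Tensor product polynomials and iterated quadrature\<close>

lemma tensor_polys_fst:
  assumes "f \<in> tensor_polys k"
  obtains p where "degree p \<le> k" "\<And>x. f x y = poly p x"
proof -
  obtain c where c: "\<And>x y. f x y = (\<Sum>a\<le>k. \<Sum>b\<le>k. c a b * x ^ a * y ^ b)"
    using assms by (auto simp: tensor_polys_def)
  show ?thesis
  proof
    show "degree (\<Sum>a\<le>k. monom (\<Sum>b\<le>k. c a b * y ^ b) a) \<le> k"
      by (intro degree_sum_le) (auto intro: order_trans[OF degree_monom_le])
    show "f x y = poly (\<Sum>a\<le>k. monom (\<Sum>b\<le>k. c a b * y ^ b) a) x" for x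
      unfolding c by (simp add: poly_sum poly_monom sum_distrib_left mult_ac)
  qed
qed

lemma tensor_polys_swap:
  assumes "f \<in> tensor_polys k"
  shows "(\<lambda>y x. f x y) \<in> tensor_polys k"
proof -
  obtain c where c: "\<And>x y. f x y = (\<Sum>a\<le>k. \<Sum>b\<le>k. c a b * x ^ a * y ^ b)"
    using assms by (auto simp: tensor_polys_def)
  have "f x y = (\<Sum>a\<le>k. \<Sum>b\<le>k. c b a * y ^ a * x ^ b)" for x y
    unfolding c by (subst sum.swap) (simp add: mult_ac)
  then show ?thesis
    unfolding tensor_polys_def by (intro CollectI exI[of _ "\<lambda>a b. c b a"]) blast
qed

lemma tensor_polys_snd:
  assumes "f \<in> tensor_polys k"
  obtains p where "degree p \<le> k" "\<And>y. f x y = poly p y"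
  using tensor_polys_fst[OF tensor_polys_swap[OF assms]] by blast

lemma tensor_polys_continuous:
  assumes "f \<in> tensor_polys k"
  shows "continuous_on S (\<lambda>(x, y). f x y)"
proof -
  obtain c where c: "\<And>x y. f x y = (\<Sum>a\<le>k. \<Sum>b\<le>k. c a b * x ^ a * y ^ b)"
    using assms by (auto simp: tensor_polys_def)
  show ?thesis
    unfolding c split_beta by (intro continuous_intros)
qed

lemma tensor_polys_const: "(\<lambda>x y. c) \<in> tensor_polys k"
proof -
  have "c = (\<Sum>a\<le>k. \<Sum>b\<le>k. (if b = 0 then if a = 0 then c else 0 else 0) * x ^ a * y ^ b)"
    for x y :: real
  proof -
    have "(\<Sum>a\<le>k. \<Sum>b\<le>k. (if b = 0 then if a = 0 then c else 0 else 0) * x ^ a * y ^ b) =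
        (\<Sum>a\<le>k. \<Sum>b\<le>k. if b = 0 then if a = 0 then c else 0 else 0)"
      by (intro sum.cong) auto
    then show ?thesis by simp
  qed
  then show ?thesis
    unfolding tensor_polys_def by (intro CollectI exI allI)
qed

text \<open>Fluxes in the x direction are estimated row by row and those in the y direction column
  by column, which nests the quadratures in opposite orders.\<close>

lemma quad_swap:
  "quad_y M k j (\<lambda>y. quad_x M k i (\<lambda>x. f x y)) = quad_x M k i (\<lambda>x. quad_y M k j (\<lambda>y. f x y))"
  unfolding quad_x_def quad_y_def sum_distrib_left
  by (subst sum.swap) (simp add: mult_ac)

lemma quad_cmult: "quad_x M k i (\<lambda>x. c * f x) = c * quad_x M k i f"
    "quad_y M k j (\<lambda>y. c * f y) = c * quad_y M k j f"
  by (simp_all add: quad_x_def quad_y_def sum_distrib_left mult_ac)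

lemma quad_add: "quad_x M k i (\<lambda>x. f x + g x) = quad_x M k i f + quad_x M k i g"
    "quad_y M k j (\<lambda>y. f y + g y) = quad_y M k j f + quad_y M k j g"
  by (simp_all add: quad_x_def quad_y_def sum.distrib algebra_simps)

lemma quad_x_mono:
  assumes "1 \<le> k" "wf_mesh M" "i < nx M"
    and "\<And>r. r \<le> k \<Longrightarrow> f (x_node M k i r) \<le> g (x_node M k i r)"
  shows "quad_x M k i f \<le> quad_x M k i g"
  unfolding quad_x_def
  by (intro mult_left_mono sum_mono; use assms hx_pos[of M i] gl_weight_pos[of k] in force)

lemma quad_y_mono:
  assumes "1 \<le> k" "wf_mesh M" "j < ny M"
    and "\<And>s. s \<le> k \<Longrightarrow> f (y_node M k j s) \<le> g (y_node M k j s)"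
  shows "quad_y M k j f \<le> quad_y M k j g"
  unfolding quad_y_def
  by (intro mult_left_mono sum_mono; use assms hy_pos[of M j] gl_weight_pos[of k] in force)

section \<open>Cell averages and bounds in terms of nodal values\<close>

lemma closure_cell:
  assumes "wf_mesh M" "i < nx M" "j < ny M"
  shows "closure (cell M i j) = {xp M i..xp M (Suc i)} \<times> {yp M j..yp M (Suc j)}"
  using assms by (simp add: cell_def closure_Times wf_mesh_def closure_greaterThanLessThan)

text \<open>Fubini's theorem reduces the double integral to one-dimensional exactness, applied first
  in y and then in x.\<close>

lemma cell_average_quad:
  assumes k: "1 \<le> k" and M: "wf_mesh M" "i < nx M" "j < ny M" and v: "v i j \<in> tensor_polys k"
  shows "hx M i * hy M j * cell_average M v i j = quad_y M k j (\<lambda>y. quad_x M k i (\<lambda>x. v i j x y))"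
proof -
  have cell: "cell M i j = box (xp M i, yp M j) (xp M (Suc i), yp M (Suc j))"
    by (auto simp: cell_def mem_box Basis_prod_def)
  have y: "integral {yp M j..yp M (Suc j)} (v i j x) = quad_y M k j (v i j x)" for x
  proof -
    obtain p where p: "degree p \<le> k" "\<And>y. v i j x y = poly p y"
      using tensor_polys_snd[OF v] by blast
    then have "v i j x = poly p" by auto
    then show ?thesis using quad_y_poly[OF k M(1,3) p(1)] by simp
  qed
  \<comment> \<open>The outer integrand is a linear combination of finitely many slices of
    \<open>v\<close>, hence again a polynomial of degree at most \<open>k\<close> in x.\<close>
  have "\<exists>q. degree q \<le> k \<and> (\<lambda>x. quad_y M k j (v i j x)) = poly q"
  proof -
    have "\<forall>y. \<exists>p. degree p \<le> k \<and> (\<forall>x. v i j x y = poly p x)"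
      using tensor_polys_fst[OF v] by metis
    then obtain P where P: "\<And>y. degree (P y) \<le> k" "\<And>x y. v i j x y = poly (P y) x"
      by metis
    define q where "q = smult (hy M j / 2) (\<Sum>s\<le>k. smult (gl_weight k s) (P (y_node M k j s)))"
    have "degree q \<le> k"
      unfolding q_def
      by (intro order_trans[OF degree_smult_le] degree_sum_le) (auto intro: P order_trans[OF degree_smult_le])
    moreover have "(\<lambda>x. quad_y M k j (v i j x)) = poly q"
      by (simp add: q_def fun_eq_iff quad_y_def P poly_sum)
    ultimately show ?thesis by blast
  qed
  then obtain q where q: "degree q \<le> k" "(\<lambda>x. quad_y M k j (v i j x)) = poly q"
    by blast
  have "integral (cell M i j) (\<lambda>(x, y). v i j x y) =
      integral {xp M i..xp M (Suc i)} (\<lambda>x. integral {yp M j..yp M (Suc j)} (v i j x))"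
    unfolding cell integral_open_interval
    by (subst integral_prod_continuous) (simp_all add: tensor_polys_continuous[OF v])
  also have "\<dots> = quad_x M k i (\<lambda>x. quad_y M k j (v i j x))"
    unfolding y q(2) by (rule quad_x_poly[OF k M(1,2) q(1)])
  also have "\<dots> = quad_y M k j (\<lambda>y. quad_x M k i (\<lambda>x. v i j x y))"
    by (rule quad_swap[symmetric])
  finally show ?thesis
    using hx_pos[OF M(1,2)] hy_pos[OF M(1,3)] by (simp add: cell_average_def)
qed

text \<open>The factor 4 is the area of the reference square.\<close>

lemma cell_average_eq_sum:
  assumes k: "1 \<le> k" and M: "wf_mesh M" "i < nx M" "j < ny M" and v: "v i j \<in> tensor_polys k"
  shows "4 * cell_average M v i j =
    (\<Sum>s\<le>k. \<Sum>r\<le>k. gl_weight k r * gl_weight k s * v i j (x_node M k i r) (y_node M k j s))"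
proof -
  have "hx M i * hy M j * (4 * cell_average M v i j) = hx M i * hy M j *
    (\<Sum>s\<le>k. \<Sum>r\<le>k. gl_weight k r * gl_weight k s * v i j (x_node M k i r) (y_node M k j s))"
    using cell_average_quad[where v = v, OF assms]
    by (simp add: quad_x_def quad_y_def sum_distrib_left mult_ac)
  then show ?thesis
    using hx_pos[OF M(1,2)] hy_pos[OF M(1,3)] by simp
qed

text \<open>Taken on the reference interval, so that it is independent of the mesh.\<close>

definition lagrange_bound :: "nat \<Rightarrow> nat \<Rightarrow> real" where
  "lagrange_bound k r = (SUP t\<in>{-1..1}. \<bar>poly (gl_lagrange k r) t\<bar>)"

lemma lagrange_bound:
  assumes "t \<in> {-1..1}"
  shows "\<bar>poly (gl_lagrange k r) t\<bar> \<le> lagrange_bound k r"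
  unfolding lagrange_bound_def
proof (rule cSUP_upper[OF assms])
  have "compact ((\<lambda>t. \<bar>poly (gl_lagrange k r) t\<bar>) ` {-1..1})"
    by (intro compact_continuous_image continuous_intros compact_Icc)
  then show "bdd_above ((\<lambda>t. \<bar>poly (gl_lagrange k r) t\<bar>) ` {-1..1})"
    by (intro bounded_imp_bdd_above compact_imp_bounded)
qed

lemma lagrange_bound_nonneg: "0 \<le> lagrange_bound k r"
  using order_trans[OF abs_ge_zero lagrange_bound[of 0 k r]] by simp

lemma tensor_interpolation:
  assumes k: "1 \<le> k" and M: "wf_mesh M" "i < nx M" "j < ny M" and f: "f \<in> tensor_polys k"
  shows "f x y = (\<Sum>s\<le>k. \<Sum>r\<le>k. f (x_node M k i r) (y_node M k j s) *
    poly (gl_lagrange k r) ((2 * x - (xp M i + xp M (Suc i))) / hx M i) *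
    poly (gl_lagrange k s) ((2 * y - (yp M j + yp M (Suc j))) / hy M j))"
proof -
  have X: "f x' y' = (\<Sum>r\<le>k. f (x_node M k i r) y' *
      poly (gl_lagrange k r) ((2 * x' - (xp M i + xp M (Suc i))) / hx M i))" for x' y'
  proof -
    obtain p where p: "degree p \<le> k" "\<And>x. f x y' = poly p x"
      using tensor_polys_fst[OF f] by blast
    show ?thesis
      unfolding p(2) x_node_def hx_def
      by (rule affine_interpolation) (use k p M in \<open>auto simp: wf_mesh_def\<close>)
  qed
  obtain p where p: "degree p \<le> k" "\<And>y. f x y = poly p y"
    using tensor_polys_snd[OF f] by blast
  have "f x y = (\<Sum>s\<le>k. f x (y_node M k j s) *
      poly (gl_lagrange k s) ((2 * y - (yp M j + yp M (Suc j))) / hy M j))"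
    unfolding p(2) y_node_def hy_def
    by (rule affine_interpolation) (use k p M in \<open>auto simp: wf_mesh_def\<close>)
  also have "\<dots> = (\<Sum>s\<le>k. \<Sum>r\<le>k. f (x_node M k i r) (y_node M k j s) *
    poly (gl_lagrange k r) ((2 * x - (xp M i + xp M (Suc i))) / hx M i) *
    poly (gl_lagrange k s) ((2 * y - (yp M j + yp M (Suc j))) / hy M j))"
    by (subst X) (simp add: sum_distrib_right)
  finally show ?thesis .
qed

text \<open>Inside the cell the rescaled coordinates lie in [-1, 1], so the interpolation formula is
  bounded by nodal values with mesh-independent factors.\<close>

lemma tensor_bound:
  assumes k: "1 \<le> k" and M: "wf_mesh M" "i < nx M" "j < ny M" and f: "f \<in> tensor_polys k"
    and xy: "(x, y) \<in> cell M i j"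
  shows "\<bar>f x y\<bar> \<le> (\<Sum>s\<le>k. \<Sum>r\<le>k. \<bar>f (x_node M k i r) (y_node M k j s)\<bar> *
    (lagrange_bound k r * lagrange_bound k s))"
proof -
  define t where "t = (2 * x - (xp M i + xp M (Suc i))) / hx M i"
  define u where "u = (2 * y - (yp M j + yp M (Suc j))) / hy M j"
  have t: "t \<in> {-1..1}" and u: "u \<in> {-1..1}"
    using xy hx_pos[OF M(1,2)] hy_pos[OF M(1,3)]
    by (auto simp: t_def u_def cell_def hx_def hy_def field_simps)
  show ?thesis
    unfolding tensor_interpolation[OF k M f, of x y] t_def[symmetric] u_def[symmetric]
    by (intro order_trans[OF sum_abs] sum_mono, unfold abs_mult mult.assoc)
       (intro mult_left_mono mult_mono lagrange_bound t u lagrange_bound_nonneg; simp)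
qed

subsection \<open>Non-negative cell averages\<close>

text \<open>The flux is density times velocity. The factorisation of \<open>F\<close> is available
  at admissible states only, hence it is used at the nodes.\<close>

lemma apply_mat_diag:
  assumes "gradient_flow_data m U S e F G" "\<rho> i j x y \<in> S" "l < m"
  shows "apply_mat m F \<rho> u i j x y l = \<rho> i j x y l * apply_mat m G \<rho> u i j x y l"
  using assms by (simp add: gradient_flow_data_def apply_mat_def mat_vec_def sum_distrib_left mult_ac)

lemma abs_le_linf_norm: "l < m \<Longrightarrow> \<bar>z l\<bar> \<le> linf_norm m z"
  unfolding linf_norm_def by (rule Max_ge) auto

text \<open>For traces taken from inside a cell the periodic index reduction is the
  identity.\<close>

lemma x_plus_cell: "i < nx M \<Longrightarrow> x_plus M v i j y = v i j (xp M i) y"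
  and x_minus_cell: "i < nx M \<Longrightarrow> x_minus M v (Suc i) j y = v i j (xp M (Suc i)) y"
  and y_plus_cell: "j < ny M \<Longrightarrow> y_plus M v i j x = v i j x (yp M j)"
  and y_minus_cell: "j < ny M \<Longrightarrow> y_minus M v i (Suc j) x = v i j x (yp M (Suc j))"
  by (simp_all add: x_plus_def x_minus_def y_plus_def y_minus_def)

text \<open>With \<open>F = diag \<rho> G\<close> the central part of the flux combines with the Lax--Friedrichs term into
  this difference; \<open>a \<ge> \<bar>v\<^sup>\<plusminus>\<bar>\<close> makes each of the two products non-negative.\<close>

lemma lax_friedrichs_split:
  fixes a :: real
  shows "(rp * vp + rm * vm) / 2 + a / 2 * (rp - rm) = rp * (a + vp) / 2 - rm * (a - vm) / 2"
  by (simp add: field_simps)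

lemma lax_friedrichs_bounds:
  fixes a :: real
  assumes "0 \<le> rp" "0 \<le> rm" "\<bar>vp\<bar> \<le> a" "\<bar>vm\<bar> \<le> a"
  shows "(rp * vp + rm * vm) / 2 + a / 2 * (rp - rm) \<le> rp * (a + vp) / 2"
    and "- (rm * (a - vm) / 2) \<le> (rp * vp + rm * vm) / 2 + a / 2 * (rp - rm)"
proof -
  have "0 \<le> rp * (a + vp)" "0 \<le> rm * (a - vm)"
    using assms by (auto intro!: mult_nonneg_nonneg)
  then show "(rp * vp + rm * vm) / 2 + a / 2 * (rp - rm) \<le> rp * (a + vp) / 2"
    and "- (rm * (a - vm) / 2) \<le> (rp * vp + rm * vm) / 2 + a / 2 * (rp - rm)"
    unfolding lax_friedrichs_split by simp_all
qed

lemma alpha_x_bounds: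
  assumes "l < m"
  shows "\<bar>x_plus M (apply_mat m G \<rho> u) p j y l\<bar> \<le> alpha_x M m G \<rho> u p j y"
    and "\<bar>x_minus M (apply_mat m G \<rho> u) p j y l\<bar> \<le> alpha_x M m G \<rho> u p j y"
  unfolding alpha_x_def by (rule max.coboundedI1 max.coboundedI2, rule abs_le_linf_norm[OF assms])+

lemma alpha_y_bounds:
  assumes "l < m"
  shows "\<bar>y_plus M (apply_mat m G \<rho> u) i q x l\<bar> \<le> alpha_y M m G \<rho> u i q x"
    and "\<bar>y_minus M (apply_mat m G \<rho> u) i q x l\<bar> \<le> alpha_y M m G \<rho> u i q x"
  unfolding alpha_y_def by (rule max.coboundedI1 max.coboundedI2, rule abs_le_linf_norm[OF assms])+

text \<open>Each bound discards the product belonging to one side of the interface. With the first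
  bound at the left interface of a cell and the second at its right interface, only the cell's own
  values of \<rho> remain.\<close>

lemma Fu_flux_x_bounds:
  assumes k: "1 \<le> k" and M: "wf_mesh M" and l: "l < m"
    and gf: "gradient_flow_data m U S e F G"
    and S: "\<forall>i<nx M. \<forall>j<ny M. \<forall>r\<le>k. \<forall>s\<le>k. \<rho> i j (x_node M k i r) (y_node M k j s) \<in> S"
    and pos: "\<forall>i<nx M. \<forall>j<ny M. \<forall>r\<le>k. \<forall>s\<le>k. 0 \<le> \<rho> i j (x_node M k i r) (y_node M k j s) l"
    and js: "j < ny M" "s \<le> k" and y: "y = y_node M k j s"
  shows "Fu_flux_x M m F G \<rho> u p j y l \<le>
           x_plus M \<rho> p j y l * (alpha_x M m G \<rho> u p j y + x_plus M (apply_mat m G \<rho> u) p j y l) / 2"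
    and "- (x_minus M \<rho> p j y l *
             (alpha_x M m G \<rho> u p j y - x_minus M (apply_mat m G \<rho> u) p j y l) / 2) \<le>
           Fu_flux_x M m F G \<rho> u p j y l"
proof -
  \<comment> \<open>The cells to the right and left of the interface. The traces are values at their
    end point nodes, where admissibility and non-negativity are known.\<close>
  define i where "i = p mod nx M"
  define i' where "i' = (p + nx M - 1) mod nx M"
  have i: "i < nx M" "i' < nx M"
    using M by (simp_all add: i_def i'_def wf_mesh_def)
  have plus: "x_plus M v p j y = v i j (x_node M k i 0) y" for v :: "(nat \<Rightarrow> real) pwfun"
    by (simp add: x_plus_def i_def x_node_first[OF k] Let_def)
  have minus: "x_minus M v p j y = v i' j (x_node M k i' k) y" for v :: "(nat \<Rightarrow> real) pwfun"
    by (simp add: x_minus_def i'_def x_node_last[OF k] Let_def)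
  have diag: "x_plus M (apply_mat m F \<rho> u) p j y l = x_plus M \<rho> p j y l * x_plus M (apply_mat m G \<rho> u) p j y l"
    "x_minus M (apply_mat m F \<rho> u) p j y l = x_minus M \<rho> p j y l * x_minus M (apply_mat m G \<rho> u) p j y l"
    unfolding plus minus by (rule apply_mat_diag[OF gf _ l]; use S i js y in simp)+
  have nonneg: "0 \<le> x_plus M \<rho> p j y l" "0 \<le> x_minus M \<rho> p j y l"
    unfolding plus minus using pos i js y by simp_all
  show "Fu_flux_x M m F G \<rho> u p j y l \<le>
           x_plus M \<rho> p j y l * (alpha_x M m G \<rho> u p j y + x_plus M (apply_mat m G \<rho> u) p j y l) / 2"
    and "- (x_minus M \<rho> p j y l *
             (alpha_x M m G \<rho> u p j y - x_minus M (apply_mat m G \<rho> u) p j y l) / 2) \<le>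
           Fu_flux_x M m F G \<rho> u p j y l"
    unfolding Fu_flux_x_def mean_def diag
    by (rule lax_friedrichs_bounds[OF nonneg alpha_x_bounds[OF l]])+
qed

lemma Fu_flux_y_bounds:
  assumes k: "1 \<le> k" and M: "wf_mesh M" and l: "l < m"
    and gf: "gradient_flow_data m U S e F G"
    and S: "\<forall>i<nx M. \<forall>j<ny M. \<forall>r\<le>k. \<forall>s\<le>k. \<rho> i j (x_node M k i r) (y_node M k j s) \<in> S"
    and pos: "\<forall>i<nx M. \<forall>j<ny M. \<forall>r\<le>k. \<forall>s\<le>k. 0 \<le> \<rho> i j (x_node M k i r) (y_node M k j s) l"
    and ir: "i < nx M" "r \<le> k" and x: "x = x_node M k i r"
  shows "Fu_flux_y M m F G \<rho> u i q x l \<le>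
           y_plus M \<rho> i q x l * (alpha_y M m G \<rho> u i q x + y_plus M (apply_mat m G \<rho> u) i q x l) / 2"
    and "- (y_minus M \<rho> i q x l *
             (alpha_y M m G \<rho> u i q x - y_minus M (apply_mat m G \<rho> u) i q x l) / 2) \<le>
           Fu_flux_y M m F G \<rho> u i q x l"
proof -
  define j where "j = q mod ny M"
  define j' where "j' = (q + ny M - 1) mod ny M"
  have j: "j < ny M" "j' < ny M"
    using M by (simp_all add: j_def j'_def wf_mesh_def)
  have plus: "y_plus M v i q x = v i j x (y_node M k j 0)" for v :: "(nat \<Rightarrow> real) pwfun"
    by (simp add: y_plus_def j_def y_node_first[OF k] Let_def)
  have minus: "y_minus M v i q x = v i j' x (y_node M k j' k)" for v :: "(nat \<Rightarrow> real) pwfun"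
    by (simp add: y_minus_def j'_def y_node_last[OF k] Let_def)
  have diag: "y_plus M (apply_mat m F \<rho> u) i q x l = y_plus M \<rho> i q x l * y_plus M (apply_mat m G \<rho> u) i q x l"
    "y_minus M (apply_mat m F \<rho> u) i q x l = y_minus M \<rho> i q x l * y_minus M (apply_mat m G \<rho> u) i q x l"
    unfolding plus minus by (rule apply_mat_diag[OF gf _ l]; use S j ir x in simp)+
  have nonneg: "0 \<le> y_plus M \<rho> i q x l" "0 \<le> y_minus M \<rho> i q x l"
    unfolding plus minus using pos j ir x by simp_all
  show "Fu_flux_y M m F G \<rho> u i q x l \<le>
           y_plus M \<rho> i q x l * (alpha_y M m G \<rho> u i q x + y_plus M (apply_mat m G \<rho> u) i q x l) / 2"
    and "- (y_minus M \<rho> i q x l *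
             (alpha_y M m G \<rho> u i q x - y_minus M (apply_mat m G \<rho> u) i q x l) / 2) \<le>
           Fu_flux_y M m F G \<rho> u i q x l"
    unfolding Fu_flux_y_def mean_def diag
    by (rule lax_friedrichs_bounds[OF nonneg alpha_y_bounds[OF l]])+
qed

text \<open>For \<open>b = 0\<close> the bound is infinite and gives no information, but then the
  conclusion only says that \<open>a\<close> is non-negative.\<close>

lemma le_half_quot_topD:
  assumes "ereal \<tau> \<le> ereal (1 / 2) * quot_top a b" "0 \<le> a" "0 \<le> b"
  shows "\<tau> * b \<le> a / 2"
  using assms by (cases "b = 0") (auto simp: quot_top_def field_simps)

lemma time_step_boundD:
  assumes k: "1 \<le> k" and M: "wf_mesh M" and l: "l < m"
    and \<tau>: "ereal \<tau> \<le> time_step_bound M k m G \<rho> ux uy l"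
    and ij: "i < nx M" "j < ny M" "r \<le> k" "s \<le> k"
    and x: "x = x_node M k i r" and y: "y = y_node M k j s"
  shows "\<tau> * (alpha_x M m G \<rho> ux i j y + x_plus M (apply_mat m G \<rho> ux) i j y l) \<le> gl_weight k 0 * hx M i / 2"
    and "\<tau> * (alpha_x M m G \<rho> ux (Suc i) j y - x_minus M (apply_mat m G \<rho> ux) (Suc i) j y l) \<le> gl_weight k k * hx M i / 2"
    and "\<tau> * (alpha_y M m G \<rho> uy i j x + y_plus M (apply_mat m G \<rho> uy) i j x l) \<le> gl_weight k 0 * hy M j / 2"
    and "\<tau> * (alpha_y M m G \<rho> uy i (Suc j) x - y_minus M (apply_mat m G \<rho> uy) i (Suc j) x l) \<le> gl_weight k k * hy M j / 2"
proof -
  define Q where "Q = {quot_top (gl_weight k 0 * hx M i)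
               (alpha_x M m G \<rho> ux i j y + x_plus M (apply_mat m G \<rho> ux) i j y l),
             quot_top (gl_weight k k * hx M i)
               (alpha_x M m G \<rho> ux (Suc i) j y - x_minus M (apply_mat m G \<rho> ux) (Suc i) j y l),
             quot_top (gl_weight k 0 * hy M j)
               (alpha_y M m G \<rho> uy i j x + y_plus M (apply_mat m G \<rho> uy) i j x l),
             quot_top (gl_weight k k * hy M j)
               (alpha_y M m G \<rho> uy i (Suc j) x - y_minus M (apply_mat m G \<rho> uy) i (Suc j) x l)}"
  have \<tau>': "ereal \<tau> \<le> ereal (1 / 2) * q" if "q \<in> Q" for q
  proof -
    have "time_step_bound M k m G \<rho> ux uy l \<le> ereal (1 / 2) * Min Q"
      unfolding time_step_bound_def
      by (intro ereal_mult_left_mono INF_lower2[where i = "(i, j, r, s)"])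
         (use ij in \<open>simp_all add: x y Q_def Let_def\<close>)
    also have "\<dots> \<le> ereal (1 / 2) * q"
      by (intro ereal_mult_left_mono Min_le) (use that in \<open>simp_all add: Q_def\<close>)
    finally show ?thesis using \<tau> by (rule order_trans[rotated])
  qed
  have pos: "0 \<le> gl_weight k 0 * hx M i" "0 \<le> gl_weight k k * hx M i"
    "0 \<le> gl_weight k 0 * hy M j" "0 \<le> gl_weight k k * hy M j"
    using gl_weight_pos[OF k, of 0] gl_weight_pos[OF k, of k] hx_pos[OF M ij(1)] hy_pos[OF M ij(2)]
    by simp_all
  show "\<tau> * (alpha_x M m G \<rho> ux i j y + x_plus M (apply_mat m G \<rho> ux) i j y l) \<le> gl_weight k 0 * hx M i / 2"
    using alpha_x_bounds(1)[OF l, of M G \<rho> ux i j y]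
    by (intro le_half_quot_topD[OF \<tau>' pos(1)]) (simp_all add: Q_def)
  show "\<tau> * (alpha_x M m G \<rho> ux (Suc i) j y - x_minus M (apply_mat m G \<rho> ux) (Suc i) j y l) \<le> gl_weight k k * hx M i / 2"
    using alpha_x_bounds(2)[OF l, of M G \<rho> ux "Suc i" j y]
    by (intro le_half_quot_topD[OF \<tau>' pos(2)]) (simp_all add: Q_def)
  show "\<tau> * (alpha_y M m G \<rho> uy i j x + y_plus M (apply_mat m G \<rho> uy) i j x l) \<le> gl_weight k 0 * hy M j / 2"
    using alpha_y_bounds(1)[OF l, of M G \<rho> uy i j x]
    by (intro le_half_quot_topD[OF \<tau>' pos(3)]) (simp_all add: Q_def)
  show "\<tau> * (alpha_y M m G \<rho> uy i (Suc j) x - y_minus M (apply_mat m G \<rho> uy) i (Suc j) x l) \<le> gl_weight k k * hy M j / 2"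
    using alpha_y_bounds(2)[OF l, of M G \<rho> uy i "Suc j" x]
    by (intro le_half_quot_topD[OF \<tau>' pos(4)]) (simp_all add: Q_def)
qed

text \<open>\<open>a\<close> and \<open>b\<close> are the values of \<rho> at the two end nodes. One
  factor 1/2 comes from the flux and one from the time step restriction; the resulting
  \<open>h / 4\<close> is half of the quadrature factor \<open>h / 2\<close>, so each direction
  consumes at most half of the old average.\<close>

lemma flux_difference_bound:
  fixes \<tau> :: real
  assumes "0 \<le> \<tau>" "0 \<le> a" "0 \<le> b" "\<tau> * A \<le> w * h / 2" "\<tau> * B \<le> w' * h / 2"
    and "fl \<le> a * A / 2" "- (b * B / 2) \<le> fr"
  shows "- (h / 4 * (w * a + w' * b)) \<le> \<tau> * (fr - fl)"
proof -
  have "a * (\<tau> * A) \<le> a * (w * h / 2)" "b * (\<tau> * B) \<le> b * (w' * h / 2)"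
    using assms by (simp_all only: mult_left_mono)
  moreover have "\<tau> * (- (b * B / 2) - a * A / 2) \<le> \<tau> * (fr - fl)"
    using assms by (intro mult_left_mono) auto
  ultimately show ?thesis by (simp add: algebra_simps)
qed

lemma end_nodes_le_sum:
  fixes f :: "nat \<Rightarrow> real"
  assumes "1 \<le> k" "\<And>r. r \<le> k \<Longrightarrow> 0 \<le> f r"
  shows "f 0 + f k \<le> (\<Sum>r\<le>k. f r)"
proof -
  have "sum f {0, k} \<le> (\<Sum>r\<le>k. f r)"
    by (rule sum_mono2) (use assms in auto)
  then show ?thesis using assms(1) by simp
qed

text \<open>The test function is the constant unit vector in direction \<open>l\<close>. Its
  derivatives vanish, which removes the volume terms and leaves the interface fluxes.\<close>

lemma euler_equation_component:
  assumes eq: "euler_equation M k m F G \<tau> \<rho> ux uy \<rho>pre" and l: "l < m"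
    and ij: "i < nx M" "j < ny M"
  shows "quad_y M k j (\<lambda>y. quad_x M k i (\<lambda>x. (\<rho>pre i j x y l - \<rho> i j x y l) / \<tau>)) =
    quad_y M k j (\<lambda>y. Fu_flux_x M m F G \<rho> ux (Suc i) j y l - Fu_flux_x M m F G \<rho> ux i j y l) +
    quad_x M k i (\<lambda>x. Fu_flux_y M m F G \<rho> uy i (Suc j) x l - Fu_flux_y M m F G \<rho> uy i j x l)"
proof -
  define \<phi> :: "(nat \<Rightarrow> real) pwfun" where "\<phi> = (\<lambda>i j x y a. if a = l then 1 else 0)"
  have \<phi>: "\<phi> \<in> dg_vec_space M k m"
    using l by (auto simp: dg_vec_space_def dg_space_def \<phi>_def topspace_Euclidean_space tensor_polys_const)
  have dot: "dot m a (\<lambda>b. if b = l then 1 else 0) = a l" for a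
    using l by (simp add: dot_def if_distrib[of "(*) _"] cong: if_cong)
  have "dx \<phi> i j x y = (\<lambda>_. 0)" "dy \<phi> i j x y = (\<lambda>_. 0)" for x y
    by (simp_all add: dx_def dy_def \<phi>_def)
  moreover have "dot m a (\<lambda>_. 0) = 0" for a by (simp add: dot_def)
  moreover have "x_plus M \<phi> p j y = (\<lambda>a. if a = l then 1 else 0)"
      "x_minus M \<phi> p j y = (\<lambda>a. if a = l then 1 else 0)"
      "y_plus M \<phi> i p x = (\<lambda>a. if a = l then 1 else 0)"
      "y_minus M \<phi> i p x = (\<lambda>a. if a = l then 1 else 0)"
      "\<phi> i j x y = (\<lambda>a. if a = l then 1 else 0)" for p x y
    by (simp_all add: \<phi>_def x_plus_def x_minus_def y_plus_def y_minus_def)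
  moreover have "quad_y M k j (\<lambda>y. quad_x M k i (\<lambda>x. 0)) = 0"
    by (simp add: quad_x_def quad_y_def)
  ultimately show ?thesis
    using eq[unfolded euler_equation_def, rule_format, OF \<phi> ij] by (simp add: dot)
qed

lemma cell_average_nonneg:
  assumes k: "1 \<le> k" and M: "wf_mesh M" and l: "l < m"
    and gf: "gradient_flow_data m U S e F G"
    and step: "euler_forward_step M k m S e F G \<tau> \<rho> ux uy \<rho>pre"
    and pos: "\<forall>i<nx M. \<forall>j<ny M. \<forall>r\<le>k. \<forall>s\<le>k. 0 \<le> \<rho> i j (x_node M k i r) (y_node M k j s) l"
    and \<tau>: "ereal \<tau> \<le> time_step_bound M k m G \<rho> ux uy l"
    and ij: "i < nx M" "j < ny M"
  shows "0 \<le> cell_average M (\<lambda>i j x y. \<rho>pre i j x y l) i j"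
proof -
  have S: "\<forall>i<nx M. \<forall>j<ny M. \<forall>r\<le>k. \<forall>s\<le>k. \<rho> i j (x_node M k i r) (y_node M k j s) \<in> S"
    and eq: "euler_equation M k m F G \<tau> \<rho> ux uy \<rho>pre" and \<tau>0: "0 < \<tau>"
    and pre: "(\<lambda>x y. \<rho>pre i j x y l) \<in> tensor_polys k"
    using step l ij by (auto simp: euler_forward_step_def dg_vec_space_def dg_space_def)
  let ?FX = "\<lambda>p y. Fu_flux_x M m F G \<rho> ux p j y l"
  let ?FY = "\<lambda>q x. Fu_flux_y M m F G \<rho> uy i q x l"
  let ?Q = "quad_y M k j (\<lambda>y. quad_x M k i (\<lambda>x. \<rho> i j x y l))"
  \<comment> \<open>The x fluxes remove at most half of the old quadrature sum, shown on each row of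
    nodes.\<close>
  have "quad_y M k j (\<lambda>y. (-1/2) * quad_x M k i (\<lambda>x. \<rho> i j x y l)) \<le>
      quad_y M k j (\<lambda>y. \<tau> * (?FX (Suc i) y - ?FX i y))"
  proof (rule quad_y_mono[OF k M ij(2)])
    fix s assume s: "s \<le> k"
    define y where "y = y_node M k j s"
    let ?a = "\<lambda>r. \<rho> i j (x_node M k i r) y l"
    have a: "0 \<le> ?a r" if "r \<le> k" for r
      using pos ij s that by (simp add: y_def)
    have "- (hx M i / 4 * (gl_weight k 0 * ?a 0 + gl_weight k k * ?a k)) \<le> \<tau> * (?FX (Suc i) y - ?FX i y)"
    proof (rule flux_difference_bound[OF less_imp_le[OF \<tau>0] a[of 0] a[of k]])
      show "?FX i y \<le> ?a 0 * (alpha_x M m G \<rho> ux i j y + x_plus M (apply_mat m G \<rho> ux) i j y l) / 2"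
        using Fu_flux_x_bounds(1)[OF k M l gf S pos ij(2) s y_def, of ux i]
        by (simp add: x_plus_cell[OF ij(1)] x_node_first[OF k])
      show "- (?a k * (alpha_x M m G \<rho> ux (Suc i) j y - x_minus M (apply_mat m G \<rho> ux) (Suc i) j y l) / 2) \<le> ?FX (Suc i) y"
        using Fu_flux_x_bounds(2)[OF k M l gf S pos ij(2) s y_def, of "Suc i" ux]
        by (simp add: x_minus_cell[OF ij(1)] x_node_last[OF k])
    qed (use time_step_boundD(1,2)[OF k M l \<tau> ij _ s refl y_def, of 0] in simp_all)
    \<comment> \<open>Interior nodes contribute non-negative terms, so the end point terms may be
      replaced by the full sum.\<close>
    moreover have "gl_weight k 0 * ?a 0 + gl_weight k k * ?a k \<le> (\<Sum>r\<le>k. gl_weight k r * ?a r)"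
      by (rule end_nodes_le_sum[OF k]) (use a gl_weight_pos[OF k] in \<open>simp add: less_imp_le\<close>)
    then have "hx M i / 4 * (gl_weight k 0 * ?a 0 + gl_weight k k * ?a k) \<le>
        hx M i / 4 * (\<Sum>r\<le>k. gl_weight k r * ?a r)"
      using hx_pos[OF M ij(1)] by (intro mult_left_mono) auto
    ultimately have "(-1/2) * quad_x M k i (\<lambda>x. \<rho> i j x y l) \<le> \<tau> * (?FX (Suc i) y - ?FX i y)"
      by (simp add: quad_x_def)
    then show "(-1/2) * quad_x M k i (\<lambda>x. \<rho> i j x (y_node M k j s) l) \<le>
        \<tau> * (?FX (Suc i) (y_node M k j s) - ?FX i (y_node M k j s))"
      by (simp only: y_def)
  qed
  \<comment> \<open>The y fluxes remove at most the other half, shown on each column.\<close>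
  moreover have "quad_x M k i (\<lambda>x. (-1/2) * quad_y M k j (\<lambda>y. \<rho> i j x y l)) \<le>
      quad_x M k i (\<lambda>x. \<tau> * (?FY (Suc j) x - ?FY j x))"
  proof (rule quad_x_mono[OF k M ij(1)])
    fix r assume r: "r \<le> k"
    define x where "x = x_node M k i r"
    let ?a = "\<lambda>s. \<rho> i j x (y_node M k j s) l"
    have a: "0 \<le> ?a s" if "s \<le> k" for s
      using pos ij r that by (simp add: x_def)
    have "- (hy M j / 4 * (gl_weight k 0 * ?a 0 + gl_weight k k * ?a k)) \<le> \<tau> * (?FY (Suc j) x - ?FY j x)"
    proof (rule flux_difference_bound[OF less_imp_le[OF \<tau>0] a[of 0] a[of k]])
      show "?FY j x \<le> ?a 0 * (alpha_y M m G \<rho> uy i j x + y_plus M (apply_mat m G \<rho> uy) i j x l) / 2"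
        using Fu_flux_y_bounds(1)[OF k M l gf S pos ij(1) r x_def, of uy j]
        by (simp add: y_plus_cell[OF ij(2)] y_node_first[OF k])
      show "- (?a k * (alpha_y M m G \<rho> uy i (Suc j) x - y_minus M (apply_mat m G \<rho> uy) i (Suc j) x l) / 2) \<le> ?FY (Suc j) x"
        using Fu_flux_y_bounds(2)[OF k M l gf S pos ij(1) r x_def, of "Suc j" uy]
        by (simp add: y_minus_cell[OF ij(2)] y_node_last[OF k])
    qed (use time_step_boundD(3,4)[OF k M l \<tau> ij r _ x_def refl, of 0] in simp_all)
    moreover have "gl_weight k 0 * ?a 0 + gl_weight k k * ?a k \<le> (\<Sum>s\<le>k. gl_weight k s * ?a s)"
      by (rule end_nodes_le_sum[OF k]) (use a gl_weight_pos[OF k] in \<open>simp add: less_imp_le\<close>)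
    then have "hy M j / 4 * (gl_weight k 0 * ?a 0 + gl_weight k k * ?a k) \<le>
        hy M j / 4 * (\<Sum>s\<le>k. gl_weight k s * ?a s)"
      using hy_pos[OF M ij(2)] by (intro mult_left_mono) auto
    ultimately have "(-1/2) * quad_y M k j (\<lambda>y. \<rho> i j x y l) \<le> \<tau> * (?FY (Suc j) x - ?FY j x)"
      by (simp add: quad_y_def)
    then show "(-1/2) * quad_y M k j (\<lambda>y. \<rho> i j (x_node M k i r) y l) \<le>
        \<tau> * (?FY (Suc j) (x_node M k i r) - ?FY j (x_node M k i r))"
      by (simp only: x_def)
  qed
  ultimately have "- ?Q \<le> \<tau> * (quad_y M k j (\<lambda>y. ?FX (Suc i) y - ?FX i y) +
      quad_x M k i (\<lambda>x. ?FY (Suc j) x - ?FY j x))"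
    unfolding quad_cmult quad_swap[symmetric] by (simp add: distrib_left)
  also have "\<dots> = \<tau> * quad_y M k j (\<lambda>y. quad_x M k i (\<lambda>x. (\<rho>pre i j x y l - \<rho> i j x y l) / \<tau>))"
    by (simp only: euler_equation_component[OF eq l ij])
  also have "\<dots> = quad_y M k j (\<lambda>y. quad_x M k i (\<lambda>x. \<rho>pre i j x y l + (- 1) * \<rho> i j x y l))"
    unfolding quad_cmult[symmetric] using \<tau>0 by simp
  also have "\<dots> = quad_y M k j (\<lambda>y. quad_x M k i (\<lambda>x. \<rho>pre i j x y l)) - ?Q"
    unfolding quad_add quad_cmult by simp
  finally have "0 \<le> quad_y M k j (\<lambda>y. quad_x M k i (\<lambda>x. \<rho>pre i j x y l))"
    by simp
  \<comment> \<open>Exactness of the quadrature turns the nodal sum into the true cell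
    average.\<close>
  then have "0 \<le> hx M i * hy M j * cell_average M (\<lambda>i j x y. \<rho>pre i j x y l) i j"
    by (subst cell_average_quad[where v = "\<lambda>i j x y. \<rho>pre i j x y l", OF k M ij pre])
  moreover have "0 < hx M i * hy M j"
    using hx_pos[OF M ij(1)] hy_pos[OF M ij(2)] by simp
  ultimately show ?thesis
    by (simp add: zero_le_mult_iff)
qed

subsection \<open>The limiter\<close>

text \<open>The products of the weights sum to 4, so a constant can be subtracted under the
  sum.\<close>

lemma cell_average_minus_eq_sum:
  assumes k: "1 \<le> k" and M: "wf_mesh M" "i < nx M" "j < ny M" and v: "v i j \<in> tensor_polys k"
  shows "4 * (cell_average M v i j - c) =
    (\<Sum>s\<le>k. \<Sum>r\<le>k. gl_weight k r * gl_weight k s * (v i j (x_node M k i r) (y_node M k j s) - c))"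
proof -
  have "(\<Sum>s\<le>k. \<Sum>r\<le>k. gl_weight k r * gl_weight k s * c) =
      (\<Sum>r\<le>k. gl_weight k r) * (\<Sum>s\<le>k. gl_weight k s) * c"
    by (subst sum.swap) (simp only: sum_product flip: sum_distrib_right)
  also have "\<dots> = 4 * c" by (simp add: sum_gl_weight[OF k])
  finally show ?thesis
    unfolding right_diff_distrib sum_subtractf cell_average_eq_sum[where v = v, OF k M v] by simp
qed

lemma nodal_min_le:
  assumes "r \<le> k" "s \<le> k"
  shows "nodal_min M k v i j \<le> v i j (x_node M k i r) (y_node M k j s)"
  unfolding nodal_min_def by (rule Min_le) (use assms in force)+

lemma nodal_min_attained:
  obtains r s where "r \<le> k" "s \<le> k" "nodal_min M k v i j = v i j (x_node M k i r) (y_node M k j s)"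
proof -
  have "nodal_min M k v i j \<in> (\<lambda>(r, s). v i j (x_node M k i r) (y_node M k j s)) ` ({..k} \<times> {..k})"
    unfolding nodal_min_def by (rule Min_in) auto
  then show ?thesis using that by auto
qed

text \<open>All terms of the average of \<open>v - min v\<close> are non-negative, so each is bounded by the whole;
  this controls the oscillation from above by the oscillation from below.\<close>

lemma nodal_deviation_bound:
  assumes k: "1 \<le> k" and M: "wf_mesh M" "i < nx M" "j < ny M" and v: "v i j \<in> tensor_polys k"
    and rs: "r \<le> k" "s \<le> k"
  shows "\<bar>v i j (x_node M k i r) (y_node M k j s) - cell_average M v i j\<bar> \<le>
    4 / (gl_weight k r * gl_weight k s) * (cell_average M v i j - nodal_min M k v i j)"
    and "nodal_min M k v i j \<le> cell_average M v i j"
proof -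
  let ?w = "gl_weight k" and ?a = "cell_average M v i j" and ?m = "nodal_min M k v i j"
  let ?v = "\<lambda>r s. v i j (x_node M k i r) (y_node M k j s)"
  have w: "0 < ?w r" "?w r \<le> 2" if "r \<le> k" for r
  proof -
    show "0 < ?w r" using gl_weight_pos[OF k that] .
    have "?w r \<le> (\<Sum>r\<le>k. ?w r)"
      by (rule member_le_sum) (use that gl_weight_pos[OF k] in \<open>auto intro: less_imp_le\<close>)
    then show "?w r \<le> 2" by (simp add: sum_gl_weight[OF k])
  qed
  have nonneg: "0 \<le> ?w r * ?w s * (?v r s - ?m)" if "r \<le> k" "s \<le> k" for r s
    using w(1)[OF that(1)] w(1)[OF that(2)] nodal_min_le[OF that, of M v i j] by simp
  have "?w r * ?w s * (?v r s - ?m) \<le> (\<Sum>r\<le>k. ?w r * ?w s * (?v r s - ?m))"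
    by (rule member_le_sum[of r "{..k}" "\<lambda>r. ?w r * ?w s * (?v r s - ?m)"]) (use rs nonneg in auto)
  also have "\<dots> \<le> (\<Sum>s\<le>k. \<Sum>r\<le>k. ?w r * ?w s * (?v r s - ?m))"
    by (rule member_le_sum[of s "{..k}" "\<lambda>s. \<Sum>r\<le>k. ?w r * ?w s * (?v r s - ?m)"])
       (use rs nonneg in \<open>auto intro!: sum_nonneg\<close>)
  also have "\<dots> = 4 * (?a - ?m)"
    using cell_average_minus_eq_sum[where v = v, OF k M v] by simp
  finally have le: "?w r * ?w s * (?v r s - ?m) \<le> 4 * (?a - ?m)" .
  with nonneg[OF rs] show ma: "?m \<le> ?a" by simp
  have ww: "0 < ?w r * ?w s" "?w r * ?w s \<le> 2 * 2"
    using w[OF rs(1)] w[OF rs(2)] by (simp, intro mult_mono) simp_all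
  have "?v r s - ?m \<le> 4 * (?a - ?m) / (?w r * ?w s)"
    unfolding pos_le_divide_eq[OF ww(1)] using le by (simp only: mult.commute)
  then have "?v r s - ?m \<le> 4 / (?w r * ?w s) * (?a - ?m)"
    by simp
  \<comment> \<open>Since the product of the weights is at most 4, the factor is at least 1. This
    handles nodal values below the average, whose distance from it is at most
    \<open>?a - ?m\<close>.\<close>
  moreover have "1 * (?a - ?m) \<le> 4 / (?w r * ?w s) * (?a - ?m)"
    using ww ma by (intro mult_right_mono) (auto simp: field_simps)
  moreover have "\<bar>?v r s - ?a\<bar> \<le> R" if "?v r s - ?m \<le> R" "1 * (?a - ?m) \<le> R" for R
    using that nodal_min_le[OF rs, of M v i j] ma by (simp add: abs_le_iff)
  ultimately show "\<bar>?v r s - ?a\<bar> \<le> 4 / (?w r * ?w s) * (?a - ?m)"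
    by blast
qed

text \<open>When the limiter acts, \<theta> scales the nodal minimum exactly to zero, so the minimum
  moves by its own negative part; otherwise \<theta> is 1 and the minimum is already
  non-negative.\<close>

lemma limiter_theta_bounds:
  assumes "0 \<le> cell_average M v i j" "nodal_min M k v i j \<le> cell_average M v i j"
  shows "0 \<le> limiter_theta M k v i j" "limiter_theta M k v i j \<le> 1"
    and "0 \<le> cell_average M v i j + limiter_theta M k v i j * (nodal_min M k v i j - cell_average M v i j)"
    and "(1 - limiter_theta M k v i j) * (cell_average M v i j - nodal_min M k v i j) \<le>
      max 0 (- nodal_min M k v i j)"
proof -
  define a where "a = cell_average M v i j"
  define n where "n = nodal_min M k v i j"
  define \<theta> where "\<theta> = limiter_theta M k v i j"
  have an: "0 \<le> a" "n \<le> a" using assms by (simp_all add: a_def n_def)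
  have \<theta>: "\<theta> = (if a = n then 1 else min (a / (a - n)) 1)"
    by (simp add: \<theta>_def limiter_theta_def a_def n_def)
  have "0 \<le> \<theta> \<and> \<theta> \<le> 1 \<and> 0 \<le> a + \<theta> * (n - a) \<and> (1 - \<theta>) * (a - n) \<le> max 0 (- n)"
  proof (cases "a = n \<or> 1 \<le> a / (a - n)")
    case True
    then have "\<theta> = 1" unfolding \<theta> by (metis min.absorb2)
    moreover have "0 \<le> n" using True an by (cases "n < a") (auto simp: le_divide_eq)
    ultimately show ?thesis by simp
  next
    case False
    then have ne: "a \<noteq> n" and le: "a / (a - n) \<le> 1" by auto
    have "\<theta> = a / (a - n)" unfolding \<theta> using ne min.absorb1[OF le] by (simp only: if_False)
    moreover have "n < a" using ne an by simp
    moreover from calculation have "\<theta> * (a - n) = a" by simp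
    then have "a + \<theta> * (n - a) = 0" "(1 - \<theta>) * (a - n) = - n"
      by (simp_all add: algebra_simps)
    ultimately show ?thesis using an le by simp
  qed
  then show "0 \<le> limiter_theta M k v i j" "limiter_theta M k v i j \<le> 1"
    and "0 \<le> cell_average M v i j + limiter_theta M k v i j * (nodal_min M k v i j - cell_average M v i j)"
    and "(1 - limiter_theta M k v i j) * (cell_average M v i j - nodal_min M k v i j) \<le>
      max 0 (- nodal_min M k v i j)"
    by (simp_all add: a_def n_def \<theta>_def)
qed

text \<open>Since \<theta> is non-negative, limiting is monotone in the nodal value, and it suffices
  to consider the minimum.\<close>

lemma limited_nonneg:
  assumes k: "1 \<le> k" and M: "wf_mesh M" "i < nx M" "j < ny M" and v: "v i j \<in> tensor_polys k"
    and avg: "0 \<le> cell_average M v i j" and lim: "limited M k v w" and rs: "r \<le> k" "s \<le> k"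
  shows "0 \<le> w i j (x_node M k i r) (y_node M k j s)"
proof -
  note \<theta> = limiter_theta_bounds[OF avg nodal_deviation_bound(2)[where v = v, OF k M v rs]]
  have "0 \<le> cell_average M v i j + limiter_theta M k v i j * (nodal_min M k v i j - cell_average M v i j)"
    by (rule \<theta>(3))
  also have "\<dots> \<le> w i j (x_node M k i r) (y_node M k j s)"
    using lim M rs \<theta>(1) nodal_min_le[OF rs, of M v i j]
    by (simp add: limited_def mult_left_mono)
  finally show ?thesis .
qed

lemma tensor_polys_diff:
  assumes "f \<in> tensor_polys k" "g \<in> tensor_polys k"
  shows "(\<lambda>x y. f x y - g x y) \<in> tensor_polys k"
proof -
  obtain c d where "\<And>x y. f x y = (\<Sum>a\<le>k. \<Sum>b\<le>k. c a b * x ^ a * y ^ b)"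
    "\<And>x y. g x y = (\<Sum>a\<le>k. \<Sum>b\<le>k. d a b * x ^ a * y ^ b)"
    using assms by (auto simp: tensor_polys_def)
  then have "f x y - g x y = (\<Sum>a\<le>k. \<Sum>b\<le>k. (c a b - d a b) * x ^ a * y ^ b)" for x y
    by (simp add: left_diff_distrib sum_subtractf)
  then show ?thesis
    unfolding tensor_polys_def by (intro CollectI exI[of _ "\<lambda>a b. c a b - d a b"]) blast
qed

text \<open>The nodal deviation factor and the Lagrange bounds, summed over the nodes of the
  reference square.\<close>

definition limiter_constant :: "nat \<Rightarrow> real" where
  "limiter_constant k = (\<Sum>s\<le>k. \<Sum>r\<le>k. 4 / (gl_weight k r * gl_weight k s) *
     (lagrange_bound k r * lagrange_bound k s))"

lemma limiter_constant_nonneg: "1 \<le> k \<Longrightarrow> 0 \<le> limiter_constant k"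
  unfolding limiter_constant_def
  by (intro sum_nonneg mult_nonneg_nonneg divide_nonneg_nonneg lagrange_bound_nonneg)
     (simp_all add: less_imp_le gl_weight_pos)

text \<open>The limited function minus the original is again a tensor product polynomial, so a bound
  at the nodes extends to the cell by \<open>tensor_bound\<close>.\<close>

lemma limited_deviation:
  assumes k: "1 \<le> k" and M: "wf_mesh M" "i < nx M" "j < ny M" and v: "v i j \<in> tensor_polys k"
    and avg: "0 \<le> cell_average M v i j" and lim: "limited M k v w" and xy: "(x, y) \<in> cell M i j"
  shows "\<bar>w i j x y - v i j x y\<bar> \<le> limiter_constant k * max 0 (- nodal_min M k v i j)"
proof -
  let ?a = "cell_average M v i j" and ?m = "nodal_min M k v i j" and ?\<theta> = "limiter_theta M k v i j"
  have w: "w i j \<in> tensor_polys k"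
    using lim M by (simp add: limited_def dg_space_def)
  note \<theta> = limiter_theta_bounds[OF avg nodal_deviation_bound(2)[where v = v, OF k M v le0 le0]]
  have node: "\<bar>w i j (x_node M k i r) (y_node M k j s) - v i j (x_node M k i r) (y_node M k j s)\<bar> \<le>
      4 / (gl_weight k r * gl_weight k s) * max 0 (- ?m)" if rs: "r \<le> k" "s \<le> k" for r s
  proof -
    let ?v = "v i j (x_node M k i r) (y_node M k j s)"
    have "w i j (x_node M k i r) (y_node M k j s) - ?v = - ((1 - ?\<theta>) * (?v - ?a))"
      using lim M rs by (simp add: limited_def algebra_simps)
    then have "\<bar>w i j (x_node M k i r) (y_node M k j s) - ?v\<bar> = (1 - ?\<theta>) * \<bar>?v - ?a\<bar>"
      using \<theta>(2) by (simp add: abs_mult)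
    also have "\<dots> \<le> (1 - ?\<theta>) * (4 / (gl_weight k r * gl_weight k s) * (?a - ?m))"
      using \<theta>(2) by (intro mult_left_mono nodal_deviation_bound(1)[where v = v, OF k M v rs]) simp
    also have "\<dots> = 4 / (gl_weight k r * gl_weight k s) * ((1 - ?\<theta>) * (?a - ?m))"
      by simp
    also have "\<dots> \<le> 4 / (gl_weight k r * gl_weight k s) * max 0 (- ?m)"
      using gl_weight_pos[OF k rs(1)] gl_weight_pos[OF k rs(2)] by (intro mult_left_mono \<theta>(4)) simp
    finally show ?thesis .
  qed
  have "\<bar>w i j x y - v i j x y\<bar> \<le> (\<Sum>s\<le>k. \<Sum>r\<le>k.
      \<bar>w i j (x_node M k i r) (y_node M k j s) - v i j (x_node M k i r) (y_node M k j s)\<bar> *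
      (lagrange_bound k r * lagrange_bound k s))"
    by (rule tensor_bound[OF k M tensor_polys_diff[OF w v] xy])
  also have "\<dots> \<le> (\<Sum>s\<le>k. \<Sum>r\<le>k. 4 / (gl_weight k r * gl_weight k s) * max 0 (- ?m) *
      (lagrange_bound k r * lagrange_bound k s))"
    by (intro sum_mono mult_right_mono mult_nonneg_nonneg lagrange_bound_nonneg node) auto
  also have "\<dots> = limiter_constant k * max 0 (- ?m)"
    by (simp add: limiter_constant_def sum_distrib_left mult_ac)
  finally show ?thesis .
qed

lemma cell_node_closure:
  assumes "1 \<le> k" "wf_mesh M" "i < nx M" "j < ny M" "r \<le> k" "s \<le> k"
  shows "(x_node M k i r, y_node M k j s) \<in> closure (cell M i j)"
  using affine_node_bounds[of k r "xp M i" "xp M (Suc i)"] affine_node_bounds[of k s "yp M j" "yp M (Suc j)"] assms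
  by (simp add: closure_cell wf_mesh_def x_node_def y_node_def hx_def hy_def)

text \<open>A negative nodal value of \<open>v\<close> is at least as far from any non-negative \<open>g\<close> as from \<open>0\<close>.\<close>

lemma nodal_min_le_error:
  assumes k: "1 \<le> k" and M: "wf_mesh M" "i < nx M" "j < ny M" and v: "v i j \<in> tensor_polys k"
    and g: "\<And>x y. 0 \<le> g x y" "continuous_on UNIV (\<lambda>(x, y). g x y)"
  shows "max 0 (- nodal_min M k v i j) \<le> (SUP (x, y)\<in>cell M i j. \<bar>g x y - v i j x y\<bar>)"
proof -
  define f where "f = (\<lambda>(x, y). \<bar>g x y - v i j x y\<bar>)"
  have cont: "continuous_on (closure (cell M i j)) f"
    unfolding f_def split_beta
    using continuous_on_subset[OF g(2) subset_UNIV, of "closure (cell M i j)"]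
      tensor_polys_continuous[OF v, of "closure (cell M i j)"]
    by (intro continuous_intros) (simp_all add: split_beta)
  \<comment> \<open>A real supremum bounds its members only if the set is bounded above; compactness
    of the closure ensures this.\<close>
  have "compact (closure (cell M i j))"
    unfolding closure_cell[OF M] by (intro compact_Times compact_Icc)
  then have "bdd_above (f ` closure (cell M i j))"
    using cont by (intro bounded_imp_bdd_above compact_imp_bounded compact_continuous_image)
  then have bdd: "bdd_above (f ` cell M i j)"
    by (rule bdd_above_mono) (intro image_mono closure_subset)
  obtain r s where rs: "r \<le> k" "s \<le> k" "nodal_min M k v i j = v i j (x_node M k i r) (y_node M k j s)"
    by (rule nodal_min_attained)
  have "max 0 (- nodal_min M k v i j) \<le> f (x_node M k i r, y_node M k j s)"
    using g(1)[of "x_node M k i r" "y_node M k j s"] by (simp add: f_def rs(3))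
  \<comment> \<open>End point nodes lie on the boundary of the open cell; continuity extends the
    bound by the supremum to the closure.\<close>
  also have "\<dots> \<le> (SUP p\<in>cell M i j. f p)"
    by (rule continuous_le_on_closure[OF cont cell_node_closure[OF k M rs(1,2)]])
       (intro cSUP_upper bdd)
  finally show ?thesis by (simp add: f_def)
qed

lemma exact_solution_slice:
  assumes "exact_solution M m S e F T \<rho>" "t \<in> {0..T}" "l < m"
  shows "0 \<le> \<rho> t x y l" "continuous_on UNIV (\<lambda>(x, y). \<rho> t x y l)"
proof -
  have "\<forall>l<m. continuous_on ({0..T} \<times> UNIV) (\<lambda>(t, x, y). \<rho> t x y l)"
    using assms(1) unfolding exact_solution_def Let_def by (elim conjE)
  moreover have "\<forall>t\<in>{0..T}. \<forall>x y. \<forall>l<m. 0 \<le> \<rho> t x y l"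
    using assms(1) unfolding exact_solution_def Let_def by (elim conjE)
  ultimately have cont: "continuous_on ({0..T} \<times> UNIV) (\<lambda>(t, x, y). \<rho> t x y l)"
    and "0 \<le> \<rho> t x y l"
    using assms(2,3) by blast+
  then show "0 \<le> \<rho> t x y l" by blast
  have "continuous_on UNIV (\<lambda>p::real \<times> real. (\<lambda>(t, x, y). \<rho> t x y l) (t, p))"
    by (rule continuous_on_compose2[OF cont]) (use assms in \<open>auto intro!: continuous_intros\<close>)
  then show "continuous_on UNIV (\<lambda>(x, y). \<rho> t x y l)"
    by (simp add: split_beta)
qed

theorem theorem3p2:
  fixes k :: nat
  assumes "1 \<le> k"
  shows "\<exists>C::real. \<forall>M m l U S e F G \<tau> \<rho> ux uy \<rho>pre.
    wf_mesh M \<and> l < m \<and> gradient_flow_data m U S e F G \<and>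
    euler_forward_step M k m S e F G \<tau> \<rho> ux uy \<rho>pre \<and>
    (\<forall>i<nx M. \<forall>j<ny M. \<forall>r\<le>k. \<forall>s\<le>k. 0 \<le> \<rho> i j (x_node M k i r) (y_node M k j s) l) \<and>
    ereal \<tau> \<le> time_step_bound M k m G \<rho> ux uy l \<longrightarrow>
      (\<forall>i<nx M. \<forall>j<ny M. 0 \<le> cell_average M (\<lambda>i j x y. \<rho>pre i j x y l) i j) \<and>
      (\<forall>\<rho>new. limited M k (\<lambda>i j x y. \<rho>pre i j x y l) \<rho>new \<longrightarrow>
        (\<forall>i<nx M. \<forall>j<ny M. \<forall>r\<le>k. \<forall>s\<le>k. 0 \<le> \<rho>new i j (x_node M k i r) (y_node M k j s)) \<and>
        (\<forall>T tn \<rho>ex. 0 \<le> tn \<and> tn + \<tau> \<le> T \<and> exact_solution M m S e F T \<rho>ex \<longrightarrow>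
          (\<forall>i<nx M. \<forall>j<ny M. \<forall>(x, y)\<in>cell M i j.
            \<bar>\<rho>new i j x y - \<rho>pre i j x y l\<bar>
              \<le> C * (SUP (x', y')\<in>cell M i j. \<bar>\<rho>ex (tn + \<tau>) x' y' l - \<rho>pre i j x' y' l\<bar>))))"
\<comment> \<open>The witness is fixed before the mesh, the data and the solution are
  introduced.\<close>
proof (intro exI[of _ "limiter_constant k"] allI impI)
  fix M m l U S e F G \<tau> \<rho> ux uy \<rho>pre
  assume H: "wf_mesh M \<and> l < m \<and> gradient_flow_data m U S e F G \<and>
    euler_forward_step M k m S e F G \<tau> \<rho> ux uy \<rho>pre \<and>
    (\<forall>i<nx M. \<forall>j<ny M. \<forall>r\<le>k. \<forall>s\<le>k. 0 \<le> \<rho> i j (x_node M k i r) (y_node M k j s) l) \<and>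
    ereal \<tau> \<le> time_step_bound M k m G \<rho> ux uy l"
  then have M: "wf_mesh M" and l: "l < m" and \<tau>: "0 < \<tau>"
    by (simp_all add: euler_forward_step_def)
  define v where "v = (\<lambda>i j x y. \<rho>pre i j x y l)"
  have avg: "0 \<le> cell_average M v i j" if "i < nx M" "j < ny M" for i j
    unfolding v_def using cell_average_nonneg[OF assms] H that by blast
  have v: "v i j \<in> tensor_polys k" if "i < nx M" "j < ny M" for i j
    using H that by (auto simp: v_def euler_forward_step_def dg_vec_space_def dg_space_def)
  have new: "0 \<le> w i j (x_node M k i r) (y_node M k j s)"
    if "limited M k v w" "i < nx M" "j < ny M" "r \<le> k" "s \<le> k" for w i j r s
    using limited_nonneg[where v = v, OF assms M] avg v that by blast
  have acc: "\<bar>w i j x y - v i j x y\<bar> \<le> limiter_constant k *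
      (SUP (x', y')\<in>cell M i j. \<bar>\<rho>ex (tn + \<tau>) x' y' l - v i j x' y'\<bar>)"
    if w: "limited M k v w" and t: "0 \<le> tn" "tn + \<tau> \<le> T" and ex: "exact_solution M m S e F T \<rho>ex"
      and ij: "i < nx M" "j < ny M" and xy: "(x, y) \<in> cell M i j" for w T tn \<rho>ex i j x y
  proof -
    have t': "tn + \<tau> \<in> {0..T}" using t \<tau> by simp
    have "\<bar>w i j x y - v i j x y\<bar> \<le> limiter_constant k * max 0 (- nodal_min M k v i j)"
      by (rule limited_deviation[where v = v, OF assms M ij v[OF ij] avg[OF ij] w xy])
    also have "\<dots> \<le> limiter_constant k *
        (SUP (x', y')\<in>cell M i j. \<bar>\<rho>ex (tn + \<tau>) x' y' l - v i j x' y'\<bar>)"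
      by (intro mult_left_mono limiter_constant_nonneg[OF assms]
            nodal_min_le_error[where v = v, OF assms M ij v[OF ij]] exact_solution_slice[OF ex t' l])
    finally show ?thesis .
  qed
  show "(\<forall>i<nx M. \<forall>j<ny M. 0 \<le> cell_average M (\<lambda>i j x y. \<rho>pre i j x y l) i j) \<and>
      (\<forall>\<rho>new. limited M k (\<lambda>i j x y. \<rho>pre i j x y l) \<rho>new \<longrightarrow>
        (\<forall>i<nx M. \<forall>j<ny M. \<forall>r\<le>k. \<forall>s\<le>k. 0 \<le> \<rho>new i j (x_node M k i r) (y_node M k j s)) \<and>
        (\<forall>T tn \<rho>ex. 0 \<le> tn \<and> tn + \<tau> \<le> T \<and> exact_solution M m S e F T \<rho>ex \<longrightarrow>
          (\<forall>i<nx M. \<forall>j<ny M. \<forall>(x, y)\<in>cell M i j.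
            \<bar>\<rho>new i j x y - \<rho>pre i j x y l\<bar>
              \<le> limiter_constant k *
                (SUP (x', y')\<in>cell M i j. \<bar>\<rho>ex (tn + \<tau>) x' y' l - \<rho>pre i j x' y' l\<bar>))))"
    using avg new acc unfolding v_def by blast
qed

end
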